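(* Let $\kappa,\lambda$ be infinite cardinals, let $\alpha$ be an infinite cardinal with $\alpha\leq\kappa^+$, and let $\beta$ be an infinite cardinal with $\beta\leq\lambda^+$. Then $P(\kappa,\alpha)$ is isomorphic to a subgroup of $P(\lambda,\beta)$ if and only if either (1) $\kappa\leq\lambda$ and $\alpha\leq\beta$, or (2) $\kappa\leq\lambda^{<\beta}$ and $\alpha=\omega$.
   Context: Cardinals are initial ordinals, identified with the set of smaller ordinals; $\omega$ is the first infinite cardinal and $\kappa^+$ is the successor cardinal of $\kappa$. For an infinite cardinal $\kappa$, $\mathbb{Z}^\kappa$ is the direct product of $\kappa$ copies of the additive group $\mathbb{Z}$, i.e. the group of functions $x:\kappa\to\mathbb{Z}$ under pointwise addition. The support of $x$ is $\mathrm{supp}(x)=\{\xi\in\kappa:x(\xi)\neq 0\}$. For an infinite cardinal $\alpha\leq\kappa^+$, $P(\kappa,\alpha)=\{x\in\mathbb{Z}^\kappa:|\mathrm{supp}(x)|<\alpha\}$, a subgroup of $\mathbb{Z}^\kappa$ (so $P(\kappa,\kappa^+)=\mathbb{Z}^\kappa$ and $P(\kappa,\omega)$ is the direct sum of $\kappa$ copies of $\mathbb{Z}$). $\lambda^{<\beta}$ denotes the cardinality of the set of functions into $\lambda$ whose domain is a cardinal less than $\beta$ (equivalently $\sup_{\gamma<\beta}\lambda^\gamma$). *)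

theory Defs
  imports Main "HOL-Library.Function_Algebras"
begin

unbundle cardinal_syntax

text \<open>Cardinals are represented by sets: the cardinal kappa is the cardinality of a set K.
  Cardinal comparisons use the library's card_of / ordLeq / ordLess / ordIso.\<close>

text \<open>Z^K realised as integer-valued functions vanishing outside K; supp within K.\<close>
definition supp :: "'a set \<Rightarrow> ('a \<Rightarrow> int) \<Rightarrow> 'a set" where
  "supp K x = {\<xi> \<in> K. x \<xi> \<noteq> 0}"

definition P :: "'a set \<Rightarrow> 'c set \<Rightarrow> ('a \<Rightarrow> int) set" where
  "P K A = {x. (\<forall>\<xi>. \<xi> \<notin> K \<longrightarrow> x \<xi> = 0) \<and> |supp K x| <o |A|}"

definition embeds :: "('a \<Rightarrow> int) set \<Rightarrow> ('b \<Rightarrow> int) set \<Rightarrow> bool" where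
  "embeds G H \<longleftrightarrow> (\<exists>f. inj_on f G \<and> f ` G \<subseteq> H \<and>
      (\<forall>x\<in>G. \<forall>y\<in>G. f (x + y) = f x + f y))"

text \<open>lambda^{<beta}: the set of functions into L whose domain is a cardinal less than beta = |B|.
  Ordinals less than beta are realised as the proper initial segments underS |B| b (b in B) of
  the canonical cardinal well-order |B| on B; such a segment is a cardinal (initial ordinal) iff
  every strictly smaller initial segment has strictly smaller cardinality.
  Functions with domain D are elements of Func D L (extensional, undefined outside D).\<close>
definition cardinal_below :: "'d set \<Rightarrow> 'd set" where
  "cardinal_below B = {b \<in> B. \<forall>b'. (b', b) \<in> |B| \<and> b' \<noteq> b \<longrightarrow>
      |underS |B| b'| <o |underS |B| b|}"

definition pow_less :: "'b set \<Rightarrow> 'd set \<Rightarrow> ('d \<times> ('d \<Rightarrow> 'b)) set" where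
  "pow_less L B = (SIGMA b:cardinal_below B. Func (underS |B| b) L)"

definition card_le :: "'a set \<Rightarrow> 'b set \<Rightarrow> bool" where
  "card_le X Y \<longleftrightarrow> |X| \<le>o |Y|"

definition card_le_succ :: "'a set \<Rightarrow> 'b set \<Rightarrow> bool" where
  "card_le_succ X Y \<longleftrightarrow> |X| \<le>o cardSuc |Y|"

definition card_is_omega :: "'a set \<Rightarrow> bool" where
  "card_is_omega X \<longleftrightarrow> |X| =o |UNIV :: nat set|"

end

theory Submission
  imports Defs "HOL-Library.Countable" "HOL-Library.Disjoint_Sets"
begin

text \<open>
  If \<open>A\<close> is countable, then \<open>P K A\<close> is free of rank \<open>|K|\<close>. It embeds into \<open>P L B\<close> as soon as
  \<open>|K| \<le> |P L B|\<close>, because the indicators of the sets \<open>Fpow S\<close>, for distinct \<open>S\<close> with \<open>|S| < |B|\<close>,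
  are independent elements of a copy of \<open>P L B\<close>.

  If \<open>A\<close> is uncountable, Specker's theorem on homomorphisms \<open>\<int>\<^sup>\<omega> \<rightarrow> \<int>\<close> applies to every coordinate
  of an embedding \<open>f\<close>: each \<open>\<eta>\<close> is in the support of \<open>f e\<^sub>\<xi>\<close> for only finitely many \<open>\<xi>\<close>, whence
  \<open>|K| \<le> |L|\<close>. If moreover \<open>|B| < |A|\<close>, choose \<open>D \<subseteq> K\<close> with \<open>|D| = |B|\<close> and for each \<open>\<xi> \<in> D\<close> a
  coordinate functional \<open>\<phi>\<^sub>\<xi>\<close> of \<open>f\<close> on \<open>\<int>\<^sup>D\<close> with \<open>\<phi>\<^sub>\<xi> e\<^sub>\<xi> \<noteq> 0\<close>; some single \<open>x\<close> satisfies \<open>\<phi>\<^sub>\<xi> x \<noteq> 0\<close> for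
  \<open>|D|\<close> many \<open>\<xi>\<close>, so that the support of \<open>f x\<close> is too large. Since \<open>D\<close> may be as large as a measurable
  cardinal, \<open>\<phi>\<^sub>\<xi>\<close> need not be determined by the values \<open>\<phi>\<^sub>\<xi> e\<^sub>\<zeta>\<close>. By Specker's theorem, however, the
  number of pairwise disjoint sets on which \<open>\<phi>\<^sub>\<xi>\<close> does not vanish is bounded. If the bound is uniform
  in \<open>\<xi>\<close>, a suitable indicator function serves as \<open>x\<close>; otherwise \<open>x\<close> is an infinite linear
  combination of indicators of disjoint sets with uniform bounds.
\<close>

section \<open>Homomorphisms from products of the integers\<close>

definition additive_map :: "(('a \<Rightarrow> int) \<Rightarrow> int) \<Rightarrow> bool" where
  "additive_map h \<longleftrightarrow> (\<forall>x y. h (x + y) = h x + h y)"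

definition ind :: "'a set \<Rightarrow> 'a \<Rightarrow> int" where
  "ind E = (\<lambda>\<xi>. if \<xi> \<in> E then 1 else 0)"

lemma additive_map_add: "additive_map h \<Longrightarrow> h (\<lambda>\<xi>. x \<xi> + y \<xi>) = h x + h y"
  unfolding additive_map_def plus_fun_def by auto

lemma additive_map_zero: "additive_map h \<Longrightarrow> h (\<lambda>\<xi>. 0) = 0"
  using additive_map_add[of h "\<lambda>_. 0" "\<lambda>_. 0"] by simp

lemma additive_map_minus: "additive_map h \<Longrightarrow> h (\<lambda>\<xi>. - x \<xi>) = - h x"
  using additive_map_add[of h "\<lambda>\<xi>. - x \<xi>" x] additive_map_zero[of h] by simp

lemma additive_map_scale:
  assumes h: "additive_map h" shows "h (\<lambda>\<xi>. c * x \<xi>) = c * h x"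
proof -
  have n: "h (\<lambda>\<xi>. int n * x \<xi>) = int n * h x" for n
  proof (induction n)
    case 0 show ?case using additive_map_zero[OF h] by simp
  next
    case (Suc n)
    have "h (\<lambda>\<xi>. int (Suc n) * x \<xi>) = h (\<lambda>\<xi>. x \<xi> + int n * x \<xi>)"
      by (simp add: algebra_simps)
    then show ?case using additive_map_add[OF h, of x "\<lambda>\<xi>. int n * x \<xi>"] Suc by (simp add: algebra_simps)
  qed
  show ?thesis
  proof (cases c rule: int_cases2)
    case (nonneg n) then show ?thesis using n by simp
  next
    case (nonpos k)
    then show ?thesis using n[of k] additive_map_minus[OF h, of "\<lambda>\<xi>. int k * x \<xi>"] by simp
  qed
qed

lemma additive_map_sum:
  assumes h: "additive_map h" and "finite I"
  shows "h (\<lambda>\<xi>. \<Sum>i\<in>I. x i \<xi>) = (\<Sum>i\<in>I. h (x i))"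
  using \<open>finite I\<close>
  by (induction I) (simp_all add: additive_map_zero[OF h] additive_map_add[OF h])

lemma additive_map_split_below:
  fixes h :: "(nat \<Rightarrow> int) \<Rightarrow> int"
  assumes h: "additive_map h"
  shows "h y = (\<Sum>i<k. y i * h (ind {i})) + h (\<lambda>n. if n < k then 0 else y n)"
proof -
  have "y = (\<lambda>n. (\<Sum>i<k. y i * ind {i} n) + (if n < k then 0 else y n))"
    by (auto simp: ind_def fun_eq_iff if_distrib[where f="\<lambda>z. _ * z"] sum.delta cong: if_cong)
  then have "h y = h (\<lambda>n. (\<Sum>i<k. y i * ind {i} n) + (if n < k then 0 else y n))" by simp
  also have "\<dots> = h (\<lambda>n. \<Sum>i<k. y i * ind {i} n) + h (\<lambda>n. if n < k then 0 else y n)"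
    by (rule additive_map_add[OF h])
  also have "h (\<lambda>n. \<Sum>i<k. y i * ind {i} n) = (\<Sum>i<k. y i * h (ind {i}))"
    using additive_map_sum[OF h, of "{..<k}" "\<lambda>i n. y i * ind {i} n"] additive_map_scale[OF h] by simp
  finally show ?thesis .
qed

text \<open>The part of \<open>y\<close> from \<open>k\<close> on is \<open>c\<close> times a
  sequence, so its image is divisible by \<open>c\<close>. Finitely many entries thus determine
  \<open>h y\<close> modulo \<open>c\<close>.\<close>

lemma additive_map_tail_dvd:
  fixes h :: "(nat \<Rightarrow> int) \<Rightarrow> int"
  assumes h: "additive_map h" and d: "\<And>n. n \<ge> k \<Longrightarrow> c dvd y n"
  shows "c dvd h y - (\<Sum>i<k. y i * h (ind {i}))"
proof -
  have "(\<lambda>n. if n < k then 0 else y n) = (\<lambda>n. c * (if n < k then 0 else y n div c))"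
    using d by (auto simp: fun_eq_iff)
  then have "h (\<lambda>n. if n < k then 0 else y n) = c * h (\<lambda>n. if n < k then 0 else y n div c)"
    using additive_map_scale[OF h] by simp
  then show ?thesis using additive_map_split_below[OF h, of y k] by simp
qed

text \<open>The coefficients \<open>c k\<close> grow so fast that \<open>h c\<close>, which is congruent modulo \<open>c k\<close> to the
  \<open>k\<close>-th partial sum, would have to equal almost all partial sums.\<close>

lemma additive_map_kills_unit_vector:
  fixes h :: "(nat \<Rightarrow> int) \<Rightarrow> int"
  assumes h: "additive_map h" shows "\<exists>n. h (ind {n}) = 0"
proof (rule ccontr)
  assume "\<nexists>n. h (ind {n}) = 0"
  then have nz: "h (ind {n}) \<noteq> 0" for n by blast
  define S where "S c k = (\<Sum>i<k. c i * h (ind {i}))" for c :: "nat \<Rightarrow> int" and k :: nat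
  have "\<exists>c. \<forall>k. (\<forall>i<k. c i dvd c k) \<and> c k > \<bar>S c k\<bar> + int k"
  proof (rule dependent_wellorder_choice[where P="\<lambda>c k r. (\<forall>i<k. c i dvd r) \<and> r > \<bar>S c k\<bar> + int k"])
    fix r :: int and f g :: "nat \<Rightarrow> int" and k :: nat
    assume "\<And>i. i < k \<Longrightarrow> f i = g i"
    then show "((\<forall>i<k. f i dvd r) \<and> r > \<bar>S f k\<bar> + int k) = ((\<forall>i<k. g i dvd r) \<and> r > \<bar>S g k\<bar> + int k)"
      by (auto simp: S_def)
  next
    fix k :: nat and c :: "nat \<Rightarrow> int"
    assume *: "\<And>i. i < k \<Longrightarrow> (\<forall>j<i. c j dvd c i) \<and> c i > \<bar>S c i\<bar> + int i"
    have pos: "c i > 0" if "i < k" for i using *[OF that] by linarith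
    define p where "p = (\<Prod>i<k. c i)"
    have p: "p > 0" unfolding p_def using pos by (intro prod_pos) auto
    define m where "m = \<bar>S c k\<bar> + int k + 1"
    have "p * m \<ge> 1 * m" using p by (intro mult_right_mono) (auto simp: m_def)
    moreover have "c i dvd p * m" if "i < k" for i
      unfolding p_def using that by (intro dvd_mult2 dvd_prodI) auto
    moreover have "m > \<bar>S c k\<bar> + int k" by (simp add: m_def)
    ultimately show "\<exists>r. (\<forall>i<k. c i dvd r) \<and> r > \<bar>S c k\<bar> + int k"
      by (intro exI[of _ "p * m"]) auto
  qed
  then obtain c where dv: "\<And>i k. i < k \<Longrightarrow> c i dvd c k" and gr: "\<And>k. c k > \<bar>S c k\<bar> + int k" by blast
  \<comment> \<open>The summand \<open>int k\<close> in the growth condition eventually absorbs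
    \<open>h c\<close>, so the difference is a multiple of \<open>c k\<close> of absolute value
    below \<open>c k\<close>.\<close>
  have eq: "h c = S c k" if k: "int k \<ge> \<bar>h c\<bar>" for k
  proof -
    have "c k dvd h c - S c k" unfolding S_def
      by (rule additive_map_tail_dvd[OF h]) (metis dv le_eq_less_or_eq dvd_refl)
    moreover have "\<bar>h c - S c k\<bar> < c k" using gr[of k] k by linarith
    ultimately show ?thesis using zdvd_not_zless[of "\<bar>h c - S c k\<bar>" "c k"] by (cases "h c - S c k = 0") auto
  qed
  define k where "k = nat \<bar>h c\<bar>"
  have "S c (Suc k) = S c k" using eq[of k] eq[of "Suc k"] by (simp add: k_def)
  then have "c k * h (ind {k}) = 0" by (simp add: S_def)
  with nz[of k] gr[of k] show False by auto
qed

text \<open>With \<open>i\<close> numbering disjoint blocks, this turns homomorphisms on arbitrary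
  products into homomorphisms on sequences.\<close>

lemma additive_map_compose:
  assumes "additive_map h" shows "additive_map (\<lambda>y. h (\<lambda>\<xi>. y (i \<xi>) * x \<xi>))"
  unfolding additive_map_def
  using additive_map_add[OF assms] by (simp add: distrib_right)

text \<open>By disjointness the \<open>x n\<close> glue to one weight function. The homomorphism on
  sequences obtained from it by \<open>additive_map_compose\<close> has the values
  \<open>h (x n)\<close> at the unit vectors.\<close>

lemma additive_map_no_disjoint_sequence:
  fixes h :: "('a \<Rightarrow> int) \<Rightarrow> int" and E :: "nat \<Rightarrow> 'a set"
  assumes h: "additive_map h" and E: "disjoint_family E"
    and x: "\<And>n \<xi>. \<xi> \<notin> E n \<Longrightarrow> x n \<xi> = 0"
  shows "\<exists>n. h (x n) = 0"
proof -
  define i where "i \<xi> = (SOME n. \<xi> \<in> E n)" for \<xi>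
  have i: "i \<xi> = n" if "\<xi> \<in> E n" for \<xi> n
  proof -
    have "\<xi> \<in> E (i \<xi>)" unfolding i_def using that by (rule someI)
    then show ?thesis using E that by (auto simp: disjoint_family_on_def)
  qed
  have eq: "(\<lambda>\<xi>. ind {n} (i \<xi>) * x (i \<xi>) \<xi>) = x n" for n
    using i x by (auto simp: ind_def fun_eq_iff)
  show ?thesis
    using additive_map_kills_unit_vector[OF additive_map_compose[OF h, of i "\<lambda>\<xi>. x (i \<xi>) \<xi>"]]
    by (simp add: eq)
qed

lemma additive_map_finite_support:
  fixes h :: "('a \<Rightarrow> int) \<Rightarrow> int"
  assumes h: "additive_map h" shows "finite {\<xi>. h (ind {\<xi>}) \<noteq> 0}"
proof (rule ccontr)
  assume "infinite {\<xi>. h (ind {\<xi>}) \<noteq> 0}"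
  then obtain s :: "nat \<Rightarrow> 'a" where s: "inj s" "range s \<subseteq> {\<xi>. h (ind {\<xi>}) \<noteq> 0}"
    using infinite_countable_subset by blast
  have "\<exists>n. h (ind {s n}) = 0"
    by (rule additive_map_no_disjoint_sequence[OF h, where E="\<lambda>n. {s n}"])
       (use s in \<open>auto simp: ind_def disjoint_family_on_def inj_def\<close>)
  with s show False by auto
qed

lemma power_dvd_all_imp_zero:
  fixes z :: int assumes "\<And>k. p ^ k dvd z" and "p \<ge> 2" shows "z = 0"
proof (rule ccontr)
  assume "z \<noteq> 0"
  define k where "k = nat \<bar>z\<bar>"
  have "\<bar>z\<bar> < 2 ^ k" unfolding k_def
    by (metis abs_ge_zero less_exp nat_0_le of_nat_less_iff of_nat_numeral of_nat_power)
  also have "(2::int) ^ k \<le> p ^ k" using assms(2) by (intro power_mono) auto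
  finally show False using assms(1)[of k] \<open>z \<noteq> 0\<close> zdvd_not_zless[of "\<bar>z\<bar>" "p ^ k"] by auto
qed

text \<open>Specker's trick: every sequence is the sum of one that is \<open>2\<close>-adically null and one that is
  \<open>3\<close>-adically null.\<close>

lemma additive_map_eq_zero:
  fixes h :: "(nat \<Rightarrow> int) \<Rightarrow> int"
  assumes h: "additive_map h" and z: "\<And>n. h (ind {n}) = 0" shows "h y = 0"
proof -
  \<comment> \<open>For every \<open>k\<close>, the entries below \<open>k\<close> contribute
    nothing and the others are multiples of \<open>p ^ k\<close>.\<close>
  have pz: "h (\<lambda>n. p ^ n * a n) = 0" if p: "p \<ge> 2" for p :: int and a
  proof (rule power_dvd_all_imp_zero[OF _ p])
    fix k show "p ^ k dvd h (\<lambda>n. p ^ n * a n)"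
      using additive_map_tail_dvd[OF h, of k "p ^ k" "\<lambda>n. p ^ n * a n"] z
      by (simp add: le_imp_power_dvd)
  qed
  have "\<exists>a b. y n = 2 ^ n * a + 3 ^ n * b" for n
  proof -
    have "coprime ((2::int) ^ n) (3 ^ n)" by simp
    then obtain u v where "u * 2 ^ n + v * 3 ^ n = (1::int)"
      using bezout_int[of "2 ^ n" "3 ^ n"] by auto
    then have "2 ^ n * (u * y n) + 3 ^ n * (v * y n) = y n"
      by (metis distrib_right mult.assoc mult.commute mult_1)
    then have "y n = 2 ^ n * (u * y n) + 3 ^ n * (v * y n)" by (rule sym)
    then show ?thesis by blast
  qed
  then obtain a b where "\<And>n. y n = 2 ^ n * a n + 3 ^ n * b n" by metis
  then have "y = (\<lambda>n. 2 ^ n * a n + 3 ^ n * b n)" by auto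
  then show ?thesis
    using additive_map_add[OF h, of "\<lambda>n. 2 ^ n * a n" "\<lambda>n. 3 ^ n * b n"] pz[of 2] pz[of 3] by simp
qed

text \<open>Cutting off the first \<open>m\<close> entries leaves a homomorphism that kills every
  unit vector and hence is zero.\<close>

lemma additive_map_eq_finite_sum:
  fixes h :: "(nat \<Rightarrow> int) \<Rightarrow> int"
  assumes h: "additive_map h" and m: "\<And>n. n \<ge> m \<Longrightarrow> h (ind {n}) = 0"
  shows "h y = (\<Sum>i<m. y i * h (ind {i}))"
proof -
  define g where "g y = h (\<lambda>n. y n * (if n < m then 0 else 1))" for y
  have g: "additive_map g" unfolding g_def using additive_map_compose[OF h, of id] by simp
  have "g (ind {n}) = 0" for n
  proof (cases "n < m")
    case True
    then have "(\<lambda>i. ind {n} i * (if i < m then 0 else 1)) = (\<lambda>_. 0)" by (auto simp: ind_def)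
    then show ?thesis by (simp add: g_def additive_map_zero[OF h])
  next
    case False
    then have "(\<lambda>i. ind {n} i * (if i < m then 0 else 1)) = ind {n}" by (auto simp: ind_def)
    then show ?thesis using m[of n] False by (simp add: g_def)
  qed
  then have "g y = 0" by (rule additive_map_eq_zero[OF g])
  moreover have "(\<lambda>n. y n * (if n < m then 0 else 1)) = (\<lambda>n. if n < m then 0 else y n)" by auto
  ultimately show ?thesis using additive_map_split_below[OF h, of y m] by (simp add: g_def)
qed

text \<open>Choose \<open>y\<close> recursively. At index \<open>k\<close> only the rows
  \<open>n \<le> k\<close> impose a condition, so finitely many values are excluded. The diagonal
  entries put the last nonzero entry of row \<open>n\<close> at an index at least \<open>n\<close>,
  and after that index the partial sum no longer changes.\<close>

lemma exists_common_nonzero: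
  fixes v :: "nat \<Rightarrow> nat \<Rightarrow> int"
  assumes diag: "\<And>n. v n n \<noteq> 0" and m: "\<And>n k. k \<ge> m n \<Longrightarrow> v n k = 0"
  shows "\<exists>y. \<forall>n. (\<Sum>i<m n. y i * v n i) \<noteq> 0"
proof -
  have "\<exists>y. \<forall>k. \<forall>n\<le>k. v n k \<noteq> 0 \<longrightarrow> (\<Sum>i<k. y i * v n i) + y k * v n k \<noteq> 0"
  proof (rule dependent_wellorder_choice[where P="\<lambda>y k r. \<forall>n\<le>k. v n k \<noteq> 0 \<longrightarrow> (\<Sum>i<k. y i * v n i) + r * v n k \<noteq> 0"])
    fix r :: int and f g :: "nat \<Rightarrow> int" and k :: nat
    assume "\<And>i. i < k \<Longrightarrow> f i = g i"
    then have "(\<Sum>i<k. f i * v n i) = (\<Sum>i<k. g i * v n i)" for n by (intro sum.cong) auto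
    then show "(\<forall>n\<le>k. v n k \<noteq> 0 \<longrightarrow> (\<Sum>i<k. f i * v n i) + r * v n k \<noteq> 0) =
      (\<forall>n\<le>k. v n k \<noteq> 0 \<longrightarrow> (\<Sum>i<k. g i * v n i) + r * v n k \<noteq> 0)" by simp
  next
    fix k :: nat and y :: "nat \<Rightarrow> int"
    \<comment> \<open>Only these values can make one of the sums vanish; when that happens the
      division is exact.\<close>
    define bad where "bad = (\<lambda>n. - (\<Sum>i<k. y i * v n i) div v n k) ` {..k}"
    have "finite bad" by (simp add: bad_def)
    then obtain r where r: "r \<notin> bad" using ex_new_if_finite infinite_UNIV_int by blast
    have "(\<Sum>i<k. y i * v n i) + r * v n k \<noteq> 0" if "n \<le> k" "v n k \<noteq> 0" for n
    proof
      assume "(\<Sum>i<k. y i * v n i) + r * v n k = 0"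
      then have "- (\<Sum>i<k. y i * v n i) = r * v n k" by linarith
      then have "r = - (\<Sum>i<k. y i * v n i) div v n k" using that(2) by simp
      with r that(1) show False by (auto simp: bad_def)
    qed
    then show "\<exists>r. \<forall>n\<le>k. v n k \<noteq> 0 \<longrightarrow> (\<Sum>i<k. y i * v n i) + r * v n k \<noteq> 0" by blast
  qed
  then obtain y where y: "\<And>k n. n \<le> k \<Longrightarrow> v n k \<noteq> 0 \<Longrightarrow> (\<Sum>i<k. y i * v n i) + y k * v n k \<noteq> 0"
    by blast
  have "(\<Sum>i<m n. y i * v n i) \<noteq> 0" for n
  proof -
    define k where "k = Max {k. v n k \<noteq> 0}"
    have fin: "finite {k. v n k \<noteq> 0}"
      by (rule finite_subset[of _ "{..<m n}"]) (use m[of n] in \<open>auto simp: linorder_not_le[symmetric]\<close>)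
    have k: "v n k \<noteq> 0" "n \<le> k" using Max_in[OF fin] diag[of n] Max_ge[OF fin] by (auto simp: k_def)
    have "k < m n" using k(1) m[of n k] by (meson linorder_not_le)
    have "v n i = 0" if "i > k" for i using Max_ge[OF fin, of i] that by (auto simp: k_def)
    then have "(\<Sum>i<m n. y i * v n i) = (\<Sum>i<Suc k. y i * v n i)"
      using \<open>k < m n\<close> by (intro sum.mono_neutral_right) auto
    then show ?thesis using y[OF k(2,1)] by simp
  qed
  then show ?thesis by blast
qed

section \<open>Null sets of a homomorphism\<close>

text \<open>Testing all functions supported in \<open>E\<close>, not only \<open>ind E\<close>,
  makes the null sets of a homomorphism an ideal.\<close>

definition null :: "(('a \<Rightarrow> int) \<Rightarrow> int) \<Rightarrow> 'a set \<Rightarrow> bool" where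
  "null h E \<longleftrightarrow> (\<forall>x. (\<forall>\<xi>. \<xi> \<notin> E \<longrightarrow> x \<xi> = 0) \<longrightarrow> h x = 0)"

text \<open>\<open>bnd h E m\<close> says that \<open>E\<close> does not contain \<open>m + 1\<close> pairwise disjoint non-null sets.\<close>

primrec bnd :: "(('a \<Rightarrow> int) \<Rightarrow> int) \<Rightarrow> 'a set \<Rightarrow> nat \<Rightarrow> bool" where
  "bnd h E 0 \<longleftrightarrow> null h E"
| "bnd h E (Suc m) \<longleftrightarrow> (\<forall>S\<subseteq>E. null h S \<or> bnd h (E - S) m)"

lemma null_mono: "null h E \<Longrightarrow> S \<subseteq> E \<Longrightarrow> null h S"
  unfolding null_def by blast

lemma null_Un:
  assumes h: "additive_map h" and "null h E" "null h F" shows "null h (E \<union> F)"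
  unfolding null_def
proof (intro allI impI)
  fix x :: "'a \<Rightarrow> int" assume x: "\<forall>\<xi>. \<xi> \<notin> E \<union> F \<longrightarrow> x \<xi> = 0"
  have "x = (\<lambda>\<xi>. (if \<xi> \<in> E then x \<xi> else 0) + (if \<xi> \<in> E then 0 else x \<xi>))" by auto
  then have "h x = h (\<lambda>\<xi>. if \<xi> \<in> E then x \<xi> else 0) + h (\<lambda>\<xi>. if \<xi> \<in> E then 0 else x \<xi>)"
    using additive_map_add[OF h] by metis
  moreover have "h (\<lambda>\<xi>. if \<xi> \<in> E then x \<xi> else 0) = 0"
    using assms(2) by (simp add: null_def)
  moreover have "h (\<lambda>\<xi>. if \<xi> \<in> E then 0 else x \<xi>) = 0"
    using assms(3) x by (auto simp: null_def)
  ultimately show "h x = 0" by simp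
qed

lemma bnd_mono: "bnd h E m \<Longrightarrow> F \<subseteq> E \<Longrightarrow> bnd h F m"
proof (induction m arbitrary: E F)
  case 0 then show ?case using null_mono by auto
next
  case (Suc m)
  show ?case unfolding bnd.simps
  proof (intro allI impI)
    fix S assume S: "S \<subseteq> F"
    then have "null h S \<or> bnd h (E - S) m" using Suc.prems by auto
    then show "null h S \<or> bnd h (F - S) m" using Suc.IH[of "E - S" "F - S"] Suc.prems(2) by blast
  qed
qed

lemma bnd_Diff:
  assumes "bnd h E m" "S \<subseteq> E" "\<not> null h S"
  obtains k where "m = Suc k" "bnd h (E - S) k"
  using assms null_mono by (cases m) auto

text \<open>A non-null subset of the union meets \<open>E\<close> or \<open>F\<close> in a non-null
  set, and removing that part lowers the corresponding bound by one.\<close>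

lemma bnd_Un:
  assumes h: "additive_map h"
  shows "bnd h E m \<Longrightarrow> bnd h F n \<Longrightarrow> bnd h (E \<union> F) (m + n)"
proof (induction "m + n" arbitrary: m n E F)
  case 0
  then show ?case using null_Un[OF h] by simp
next
  case (Suc k)
  show ?case unfolding Suc.hyps(2)[symmetric] bnd.simps
  proof (intro allI impI)
    fix S assume S: "S \<subseteq> E \<union> F"
    have "bnd h (E \<union> F - S) k" if nS: "\<not> null h S"
    proof -
      have "\<not> null h (S \<inter> E) \<or> \<not> null h (S \<inter> F)"
        using nS null_Un[OF h, of "S \<inter> E" "S \<inter> F"] S by (metis Int_Un_distrib inf.absorb1)
      then show "bnd h (E \<union> F - S) k"
      proof
        assume *: "\<not> null h (S \<inter> E)"
        obtain m' where m': "m = Suc m'" "bnd h (E - S \<inter> E) m'"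
          by (rule bnd_Diff[OF Suc.prems(1) _ *]) auto
        have "bnd h ((E - S \<inter> E) \<union> (F - S)) (m' + n)"
          using Suc.hyps(2) m' bnd_mono[OF Suc.prems(2), of "F - S"] by (intro Suc.hyps(1)) auto
        moreover have "(E - S \<inter> E) \<union> (F - S) = E \<union> F - S" by blast
        ultimately show ?thesis using Suc.hyps(2) m' by simp
      next
        assume *: "\<not> null h (S \<inter> F)"
        obtain n' where n': "n = Suc n'" "bnd h (F - S \<inter> F) n'"
          by (rule bnd_Diff[OF Suc.prems(2) _ *]) auto
        have "bnd h ((E - S) \<union> (F - S \<inter> F)) (m + n')"
          using Suc.hyps(2) n' bnd_mono[OF Suc.prems(1), of "E - S"] by (intro Suc.hyps(1)) auto
        moreover have "(E - S) \<union> (F - S \<inter> F) = E \<union> F - S" by blast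
        ultimately show ?thesis using Suc.hyps(2) n' by simp
      qed
    qed
    then show "null h S \<or> bnd h (E \<union> F - S) k" by blast
  qed
qed

text \<open>Otherwise a set without bound could be split forever into a non-null piece and a
  remainder without bound, and the pieces would form an infinite sequence of disjoint non-null
  sets.\<close>

lemma additive_map_bnd:
  fixes h :: "('a \<Rightarrow> int) \<Rightarrow> int"
  assumes h: "additive_map h" shows "\<exists>m. bnd h E m"
proof (rule ccontr)
  assume nb: "\<nexists>m. bnd h E m"
  define big where "big E \<longleftrightarrow> (\<nexists>m. bnd h E m)" for E
  have split: "\<exists>F. F \<subseteq> E \<and> big F \<and> \<not> null h (E - F)" if "big E" for E
  proof -
    have "\<not> bnd h E (Suc 0)" using that unfolding big_def by blast
    then obtain S where S: "S \<subseteq> E" "\<not> null h S" "\<not> null h (E - S)" by auto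
    \<comment> \<open>Bounds for both parts would add up to a bound for \<open>E\<close>. Keep a
      part without bound and split off the other one, which is non-null.\<close>
    then have "big S \<or> big (E - S)"
      using that bnd_Un[OF h, of S _ "E - S"] by (metis Diff_partition big_def)
    moreover have "E - (E - S) = S" using S(1) by blast
    ultimately show ?thesis using S by (metis Diff_subset)
  qed
  have "\<exists>E. \<forall>n. big (E n) \<and> (E (Suc n) \<subseteq> E n \<and> \<not> null h (E n - E (Suc n)))"
    by (rule dependent_nat_choice) (use nb split big_def in blast)+
  then obtain E where E: "\<And>n. E (Suc n) \<subseteq> E n" "\<And>n. \<not> null h (E n - E (Suc n))" by blast
  then have "\<exists>x. \<forall>n. (\<forall>\<xi>. \<xi> \<notin> E n - E (Suc n) \<longrightarrow> x n \<xi> = 0) \<and> h (x n) \<noteq> 0"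
    unfolding null_def by (intro choice) blast
  then obtain x where x: "\<And>n \<xi>. \<xi> \<notin> E n - E (Suc n) \<Longrightarrow> x n \<xi> = 0" "\<And>n. h (x n) \<noteq> 0" by blast
  have dec: "E n \<subseteq> E m" if "m \<le> n" for m n using E(1) that by (rule lift_Suc_antimono_le)
  have "disjoint_family (\<lambda>n. E n - E (Suc n))"
  proof -
    have "(E m - E (Suc m)) \<inter> (E n - E (Suc n)) = {}" if "m < n" for m n
      using dec[of "Suc m" n] that by auto
    then show ?thesis unfolding disjoint_family_on_def by (metis Int_commute nat_neq_iff)
  qed
  from additive_map_no_disjoint_sequence[where x=x, OF h this x(1)] x(2) show False by blast
qed

text \<open>Split \<open>D\<close> into \<open>|D|\<close> pieces of size \<open>|D|\<close>. Either one of the pieces has the required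
  property, or some transversal lowers the bound \<open>m\<close>.\<close>

lemma free_subset_if_bnd:
  fixes D :: "'a set" and \<phi> :: "'a \<Rightarrow> ('a \<Rightarrow> int) \<Rightarrow> int"
  assumes "infinite D" and "\<And>\<xi>. \<xi> \<in> D \<Longrightarrow> bnd (\<phi> \<xi>) (D - {\<xi>}) m"
  shows "\<exists>X\<subseteq>D. |X| =o |D| \<and> (\<forall>\<xi>\<in>X. null (\<phi> \<xi>) (X - {\<xi>}))"
  using assms
proof (induction m arbitrary: D)
  case 0
  then show ?case by (intro exI[of _ D]) (auto simp: card_of_refl)
next
  case (Suc m)
  have "|D \<times> D| =o |D|" using Suc.prems(1) by (rule card_of_Times_same_infinite)
  then obtain p where p: "bij_betw p (D \<times> D) D" using card_of_ordIso by blast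
  define E where "E i = p ` ({i} \<times> D)" for i
  have inj: "inj_on p (D \<times> D)" and img: "p ` (D \<times> D) = D" using p by (auto simp: bij_betw_def)
  have ED: "E i \<subseteq> D" if "i \<in> D" for i using img that by (auto simp: E_def)
  have cE: "|E i| =o |D|" if "i \<in> D" for i
  proof -
    have "bij_betw (\<lambda>d. p (i, d)) D (E i)"
      unfolding bij_betw_def E_def using that inj by (auto simp: inj_on_def)
    then show ?thesis using card_of_ordIsoI ordIso_symmetric by blast
  qed
  have dis: "i = j" if "i \<in> D" "j \<in> D" "\<xi> \<in> E i" "\<xi> \<in> E j" for i j \<xi>
    using that inj by (auto simp: E_def inj_on_def)
  show ?case
  proof (cases "\<exists>i\<in>D. \<forall>\<xi>\<in>E i. null (\<phi> \<xi>) (E i - {\<xi>})")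
    case True
    then show ?thesis using ED cE by blast
  next
    case False
    then obtain t where t: "\<And>i. i \<in> D \<Longrightarrow> t i \<in> E i" "\<And>i. i \<in> D \<Longrightarrow> \<not> null (\<phi> (t i)) (E i - {t i})"
      by metis
    have "inj_on t D" using t(1) dis by (metis inj_onI)
    then have c: "|t ` D| =o |D|"
      by (meson bij_betw_imageI card_of_ordIsoI ordIso_symmetric)
    have tD: "t ` D \<subseteq> D" using t(1) ED by blast
    \<comment> \<open>The other points of the transversal lie in other pieces, so they avoid
      \<open>E i - {\<xi>}\<close>, which is non-null for \<open>\<phi> \<xi>\<close>. Removing that
      set costs one unit of the bound.\<close>
    have "bnd (\<phi> \<xi>) (t ` D - {\<xi>}) m" if \<xi>: "\<xi> \<in> t ` D" for \<xi>
    proof -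
      obtain i where i: "i \<in> D" "\<xi> = t i" using \<xi> by blast
      have "bnd (\<phi> \<xi>) (D - {\<xi>}) (Suc m)" using Suc.prems(2) tD \<xi> by blast
      moreover have "E i - {\<xi>} \<subseteq> D - {\<xi>}" using ED[OF i(1)] by blast
      ultimately have "bnd (\<phi> \<xi>) (D - {\<xi>} - (E i - {\<xi>})) m" using t(2)[OF i(1)] i(2) by auto
      moreover have "t ` D - {\<xi>} \<subseteq> D - {\<xi>} - (E i - {\<xi>})"
        using tD dis t(1) i by blast
      ultimately show ?thesis by (rule bnd_mono)
    qed
    moreover have "infinite (t ` D)" using c Suc.prems(1) card_of_ordIso_finite by blast
    ultimately have "\<exists>X\<subseteq>t ` D. |X| =o |t ` D| \<and> (\<forall>\<xi>\<in>X. null (\<phi> \<xi>) (X - {\<xi>}))"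
      by (intro Suc.IH)
    then obtain X where X: "X \<subseteq> t ` D" "|X| =o |t ` D|" "\<forall>\<xi>\<in>X. null (\<phi> \<xi>) (X - {\<xi>})"
      by blast
    have "|X| =o |D|" using X(2) c by (rule ordIso_transitive)
    then show ?thesis using X(1,3) tD by (meson subset_trans)
  qed
qed

section \<open>Indicators of disjoint sets and their infinite combinations\<close>

lemma null_Diff_imp_ind:
  assumes h: "additive_map h" and "null h (X - {\<xi>})" "\<xi> \<in> X"
  shows "h (ind X) = h (ind {\<xi>})"
proof -
  have "ind X = (\<lambda>\<eta>. ind {\<xi>} \<eta> + ind (X - {\<xi>}) \<eta>)" using assms(3) by (auto simp: ind_def)
  then have "h (ind X) = h (ind {\<xi>}) + h (ind (X - {\<xi>}))" using additive_map_add[OF h] by metis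
  moreover have "h (ind (X - {\<xi>})) = 0" using assms(2) by (auto simp: null_def ind_def)
  ultimately show ?thesis by simp
qed

text \<open>For disjoint \<open>X n\<close> this is the infinite linear combination of the
  \<open>ind (X n)\<close> with coefficients \<open>y n\<close>, in the form that
  \<open>additive_map_compose\<close> accepts. Points outside the union get an arbitrary index,
  neutralised by the factor \<open>ind\<close>.\<close>

definition comb :: "(nat \<Rightarrow> 'a set) \<Rightarrow> (nat \<Rightarrow> int) \<Rightarrow> 'a \<Rightarrow> int" where
  "comb X y = (\<lambda>\<xi>. y (SOME n. \<xi> \<in> X n) * ind (\<Union>n. X n) \<xi>)"

lemma comb_ind:
  assumes X: "disjoint_family X" shows "comb X (ind {n}) = ind (X n)"
proof -
  have "(SOME n. \<xi> \<in> X n) = n" if "\<xi> \<in> X n" for \<xi> n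
  proof -
    have "\<xi> \<in> X (SOME n. \<xi> \<in> X n)" using that by (rule someI)
    then show ?thesis using X that by (auto simp: disjoint_family_on_def)
  qed
  then show ?thesis by (auto simp: comb_def ind_def fun_eq_iff)
qed

lemma additive_map_comb: "additive_map h \<Longrightarrow> additive_map (\<lambda>y. h (comb X y))"
  unfolding comb_def by (rule additive_map_compose)

lemma additive_map_disjoint_family_eventually_zero:
  fixes X :: "nat \<Rightarrow> 'a set"
  assumes h: "additive_map h" and X: "disjoint_family X"
  shows "\<exists>m. \<forall>k\<ge>m. h (ind (X k)) = 0"
proof -
  have "finite {k. h (ind (X k)) \<noteq> 0}"
    using additive_map_finite_support[OF additive_map_comb[OF h, of X]] by (simp add: comb_ind[OF X])
  then obtain m where "\<forall>k\<in>{k. h (ind (X k)) \<noteq> 0}. k < m" by (auto simp: finite_nat_set_iff_bounded)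
  then have "\<forall>k\<ge>m. h (ind (X k)) = 0" by force
  then show ?thesis ..
qed

text \<open>All functionals indexed by \<open>Y n\<close> share the row \<open>v n\<close> of values
  at the \<open>ind (X k)\<close>, hence agree on every combination \<open>comb X y\<close>. So only
  countably many conditions on \<open>y\<close> remain.\<close>

lemma exists_common_nonvanishing_sequence:
  fixes \<phi> :: "'a \<Rightarrow> ('a \<Rightarrow> int) \<Rightarrow> int" and X Y :: "nat \<Rightarrow> 'a set"
  assumes add: "\<And>\<xi>. additive_map (\<phi> \<xi>)" and X: "disjoint_family X"
    and Yne: "\<And>n. Y n \<noteq> {}"
    and Y: "\<And>n \<xi> k. \<xi> \<in> Y n \<Longrightarrow> \<phi> \<xi> (ind (X k)) = v n k" and v: "\<And>n. v n n \<noteq> 0"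
  shows "\<exists>x. \<forall>n. \<forall>\<xi>\<in>Y n. \<phi> \<xi> x \<noteq> 0"
proof -
  have "\<exists>m. \<forall>k\<ge>m. v n k = 0" for n
  proof -
    obtain \<xi> where "\<xi> \<in> Y n" using Yne by blast
    then show ?thesis
      using additive_map_disjoint_family_eventually_zero[OF add[of \<xi>] X] by (simp add: Y)
  qed
  then obtain m where m: "\<And>n k. k \<ge> m n \<Longrightarrow> v n k = 0" by metis
  obtain y where y: "\<And>n. (\<Sum>i<m n. y i * v n i) \<noteq> 0" using exists_common_nonzero[of v m, OF v m] by blast
  have "\<phi> \<xi> (comb X y) \<noteq> 0" if "\<xi> \<in> Y n" for \<xi> n
  proof -
    have "\<phi> \<xi> (comb X y) = (\<Sum>i<m n. y i * \<phi> \<xi> (comb X (ind {i})))"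
      by (rule additive_map_eq_finite_sum[OF additive_map_comb[OF add]])
         (simp add: comb_ind[OF X] Y[OF that] m)
    then show ?thesis using y by (simp add: comb_ind[OF X] Y[OF that])
  qed
  then show ?thesis by blast
qed

section \<open>An element on which many functionals do not vanish\<close>

lemma finite_ordLess_card_of:
  assumes "finite S" "infinite A" shows "|S| <o |A|"
  using finite_ordLess_infinite[OF card_of_Well_order card_of_Well_order, of S A] assms
  by (simp add: Field_card_of)

lemma card_of_UNION_nat_ordLeq:
  assumes "infinite M" "\<And>n::nat. |C n| \<le>o |M|" shows "|\<Union>n. C n| \<le>o |M|"
  using assms by (intro card_of_UNION_ordLeq_infinite) (auto simp: infinite_iff_card_of_nat)

lemma countable_finite_support:
  "|{f :: nat \<Rightarrow> int. \<exists>m. \<forall>k\<ge>m. f k = 0}| \<le>o |UNIV :: nat set|"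
proof -
  have "{f :: nat \<Rightarrow> int. \<exists>m. \<forall>k\<ge>m. f k = 0} \<subseteq> range (\<lambda>l n. if n < length l then l ! n else 0)"
  proof
    fix f :: "nat \<Rightarrow> int" assume "f \<in> {f. \<exists>m. \<forall>k\<ge>m. f k = 0}"
    then obtain m where "\<forall>k\<ge>m. f k = 0" by blast
    then have "f = (\<lambda>n. if n < length (map f [0..<m]) then map f [0..<m] ! n else 0)" by auto
    then show "f \<in> range (\<lambda>l n. if n < length l then l ! n else 0)" by blast
  qed
  then have "|{f :: nat \<Rightarrow> int. \<exists>m. \<forall>k\<ge>m. f k = 0}| \<le>o |UNIV :: int list set|"
    by (meson card_of_image card_of_mono1 ordLeq_transitive)
  also have "|UNIV :: int list set| \<le>o |UNIV :: nat set|"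
    using card_of_ordLeq[of "UNIV :: int list set" "UNIV :: nat set"] inj_to_nat by blast
  finally show ?thesis .
qed

text \<open>Otherwise \<open>X\<close> would be a countable union of sets no larger than some
  infinite set smaller than \<open>X\<close>. A fibre of size \<open>|X|\<close> need not exist,
  since \<open>|X|\<close> may have countable cofinality; hence the smaller cardinal
  \<open>|C|\<close>.\<close>

lemma large_fibre:
  assumes V: "|V| \<le>o |UNIV :: nat set|" and f: "f ` X \<subseteq> V"
    and X: "|C| <o |X|" "|UNIV :: nat set| <o |X|"
  shows "\<exists>v\<in>V. |C| \<le>o |{\<xi> \<in> X. f \<xi> = v}|"
proof (rule ccontr)
  assume neg: "\<not> ?thesis"
  define M where "M = C <+> (UNIV :: nat set)"
  have infM: "infinite M" by (simp add: M_def)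
  have infX: "infinite X" using X(2) by (meson card_of_ordLeq_infinite infinite_UNIV_nat ordLess_imp_ordLeq)
  have "|M| <o |X|" unfolding M_def using infX X by (rule card_of_Plus_ordLess_infinite)
  have "|\<Union>v\<in>V. {\<xi> \<in> X. f \<xi> = v}| \<le>o |M|"
  proof (rule card_of_UNION_ordLeq_infinite[OF infM])
    show "|V| \<le>o |M|" using V infM infinite_iff_card_of_nat ordLeq_transitive by blast
    show "\<forall>v\<in>V. |{\<xi> \<in> X. f \<xi> = v}| \<le>o |M|"
    proof
      fix v assume "v \<in> V"
      then have "|{\<xi> \<in> X. f \<xi> = v}| \<le>o |C|"
        using neg by (meson card_of_Well_order ordLess_imp_ordLeq ordLess_or_ordLeq)
      also have "|C| \<le>o |M|" unfolding M_def by (rule card_of_Plus1)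
      finally show "|{\<xi> \<in> X. f \<xi> = v}| \<le>o |M|" .
    qed
  qed
  moreover have "X \<subseteq> (\<Union>v\<in>V. {\<xi> \<in> X. f \<xi> = v})" using f by blast
  ultimately have "|X| \<le>o |M|" using card_of_mono1 ordLeq_transitive by blast
  with \<open>|M| <o |X|\<close> show False using not_ordLess_ordLeq by blast
qed

text \<open>If all pieces after \<open>m\<close> were countable or at most as large as
  \<open>C k\<close>, then finitely many pieces and a countable set would bound the size of every
  piece and of the union \<open>D\<close>. But finitely many smaller pieces stay below
  \<open>|D|\<close>.\<close>

lemma exists_larger_piece:
  fixes C :: "nat \<Rightarrow> 'a set"
  assumes D: "D = (\<Union>n. C n)" and unc: "|UNIV :: nat set| <o |D|" and C: "\<And>n. |C n| <o |D|"
  shows "\<exists>n>m. |C k| <o |C n| \<and> |UNIV :: nat set| <o |C n|"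
proof (rule ccontr)
  assume neg: "\<not> ?thesis"
  have infD: "infinite D" using unc by (meson card_of_ordLeq_infinite infinite_UNIV_nat ordLess_imp_ordLeq)
  have fin: "|\<Union>n<j. C n| <o |D|" for j
  proof (induction j)
    case 0
    then show ?case using finite_ordLess_card_of[OF finite.emptyI infD] by simp
  next
    case (Suc j)
    have "(\<Union>n<Suc j. C n) = (\<Union>n<j. C n) \<union> C j" by (auto simp: less_Suc_eq)
    then show ?case using card_of_Un_ordLess_infinite[OF infD Suc C[of j]] by simp
  qed
  define N where "N = (\<Union>n<Suc (max m k). C n)"
  define M where "M = N <+> (UNIV :: nat set)"
  have infM: "infinite M" by (simp add: M_def)
  have "|M| <o |D|" unfolding M_def N_def using infD fin unc by (rule card_of_Plus_ordLess_infinite)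
  have N: "|N| \<le>o |M|" unfolding M_def by (rule card_of_Plus1)
  have sub: "|C n| \<le>o |M|" if "n \<le> max m k" for n
  proof -
    have "C n \<subseteq> N" using that unfolding N_def by (auto simp: less_Suc_eq_le)
    then show ?thesis using N card_of_mono1 ordLeq_transitive by blast
  qed
  have "|C n| \<le>o |M|" for n
  proof (cases "n \<le> m")
    case True then show ?thesis by (intro sub) auto
  next
    case False
    then have "|C n| \<le>o |C k| \<or> |C n| \<le>o |UNIV :: nat set|"
      using neg by (meson card_of_Well_order not_le ordLess_or_ordLeq)
    moreover have "|UNIV :: nat set| \<le>o |M|" using infM infinite_iff_card_of_nat by blast
    ultimately show ?thesis using sub[of k] ordLeq_transitive by (metis max.cobounded2)
  qed
  then have "|D| \<le>o |M|" unfolding D by (rule card_of_UNION_nat_ordLeq[OF infM])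
  with \<open>|M| <o |D|\<close> show False using not_ordLess_ordLeq by blast
qed

text \<open>\<open>D\<close> is sorted by the bounds \<open>r \<xi>\<close>. If no piece
  \<open>C n\<close> has full size and \<open>D\<close> is uncountable, then \<open>|D|\<close> has
  countable cofinality, and infinitely many pieces must be treated at once.\<close>

lemma large_common_nonvanishing:
  fixes D :: "'a set" and \<phi> :: "'a \<Rightarrow> ('a \<Rightarrow> int) \<Rightarrow> int"
  assumes infD: "infinite D" and add: "\<And>\<xi>. additive_map (\<phi> \<xi>)"
    and nz: "\<And>\<xi>. \<xi> \<in> D \<Longrightarrow> \<phi> \<xi> (ind {\<xi>}) \<noteq> 0"
  shows "\<exists>x. \<exists>Y\<subseteq>D. |D| \<le>o |Y| \<and> (\<forall>\<xi>\<in>Y. \<phi> \<xi> x \<noteq> 0)"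
proof -
  obtain r where r: "\<And>\<xi>. bnd (\<phi> \<xi>) UNIV (r \<xi>)"
    using additive_map_bnd[OF add, where E=UNIV] by metis
  define C where "C n = {\<xi> \<in> D. r \<xi> = n}" for n
  have CD: "C n \<subseteq> D" for n by (auto simp: C_def)
  have free: "\<exists>X\<subseteq>C n. |X| =o |C n| \<and> (\<forall>\<xi>\<in>X. \<phi> \<xi> (ind X) \<noteq> 0)" if "infinite (C n)" for n
  proof -
    have "\<exists>X\<subseteq>C n. |X| =o |C n| \<and> (\<forall>\<xi>\<in>X. null (\<phi> \<xi>) (X - {\<xi>}))"
      by (rule free_subset_if_bnd[OF that, where m=n]) (use r in \<open>auto simp: C_def intro: bnd_mono\<close>)
    then obtain X where X: "X \<subseteq> C n" "|X| =o |C n|" "\<And>\<xi>. \<xi> \<in> X \<Longrightarrow> null (\<phi> \<xi>) (X - {\<xi>})" by blast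
    \<comment> \<open>\<open>X - {\<xi>}\<close> is null, so \<open>\<phi> \<xi>\<close> takes the
      same value at \<open>ind X\<close> as at \<open>ind {\<xi>}\<close>.\<close>
    have "\<phi> \<xi> (ind X) \<noteq> 0" if "\<xi> \<in> X" for \<xi>
      using null_Diff_imp_ind[OF add X(3)[OF that] that] nz[of \<xi>] X(1) CD that by auto
    then show ?thesis using X by blast
  qed
  consider (large) n where "|D| \<le>o |C n|" | (countable) "|D| \<le>o |UNIV :: nat set|"
    | (unbounded) "\<And>n. |C n| <o |D|" "|UNIV :: nat set| <o |D|"
    by (meson card_of_Well_order ordLess_or_ordLeq)
  then show ?thesis
  proof cases
    case (large n)
    then have "infinite (C n)" using infD card_of_ordLeq_infinite by blast
    from free[OF this] obtain X where X: "X \<subseteq> C n" "|X| =o |C n|" "\<forall>\<xi>\<in>X. \<phi> \<xi> (ind X) \<noteq> 0" by blast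
    have "|D| \<le>o |X|" using large X(2) ordIso_symmetric ordLeq_ordIso_trans by blast
    then show ?thesis using X CD by blast
  next
    case countable
    have "|UNIV :: nat set| =o |D|"
      using countable infD by (simp add: infinite_iff_card_of_nat ordIso_iff_ordLeq)
    then obtain s where s: "bij_betw s (UNIV :: nat set) D" using card_of_ordIso by blast
    have sD: "s n \<in> D" for n using s by (auto simp: bij_betw_def)
    have "\<exists>x. \<forall>n. \<forall>\<xi>\<in>{s n}. \<phi> \<xi> x \<noteq> 0"
    proof (rule exists_common_nonvanishing_sequence[OF add, where X="\<lambda>n. {s n}" and v="\<lambda>n k. \<phi> (s n) (ind {s k})"])
      show "disjoint_family (\<lambda>n. {s n})"
        using s by (auto simp: disjoint_family_on_def bij_betw_def inj_def)
    qed (use nz sD in auto)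
    then obtain x where "\<And>n. \<phi> (s n) x \<noteq> 0" by blast
    then have "\<forall>\<xi>\<in>D. \<phi> \<xi> x \<noteq> 0" using s by (auto simp: bij_betw_def)
    then show ?thesis by (meson card_of_refl ordIso_imp_ordLeq subset_refl)
  next
    case unbounded
    have D: "D = (\<Union>n. C n)" by (auto simp: C_def)
    let ?Q = "\<lambda>k n. |C k| <o |C n| \<and> |UNIV :: nat set| <o |C n|"
    \<comment> \<open>The piece \<open>C (s k)\<close> exceeds \<open>C k\<close>, leaving room to
      pass to a fibre that is still at least as large as \<open>C k\<close>. As \<open>s\<close>
      increases strictly, the chosen pieces are disjoint.\<close>
    have "\<exists>s. \<forall>k. ?Q k (s k) \<and> s k < s (Suc k)"
      using exists_larger_piece[OF D unbounded(2,1)]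
      by (intro dependent_nat_choice) blast+
    then obtain s where s: "\<And>k. ?Q k (s k)" "\<And>k. s k < s (Suc k)" by blast
    have "strict_mono s" using s(2) by (simp add: strict_mono_Suc_iff)
    then have injs: "inj s" by (rule strict_mono_imp_inj_on)
    have "infinite (C (s k))" for k
      using s(1)[of k] by (meson card_of_ordLeq_infinite infinite_UNIV_nat ordLess_imp_ordLeq)
    then have "\<forall>k. \<exists>X. X \<subseteq> C (s k) \<and> |X| =o |C (s k)| \<and> (\<forall>\<xi>\<in>X. \<phi> \<xi> (ind X) \<noteq> 0)"
      using free by blast
    then obtain X where X: "\<And>k. X k \<subseteq> C (s k)" "\<And>k. |X k| =o |C (s k)|"
        "\<And>k \<xi>. \<xi> \<in> X k \<Longrightarrow> \<phi> \<xi> (ind (X k)) \<noteq> 0"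
      by metis
    have disj: "disjoint_family X"
    proof -
      have "r \<xi> = s i" if "\<xi> \<in> X i" for \<xi> i
        using subsetD[OF X(1) that] by (simp add: C_def)
      then have "X i \<inter> X j = {}" if "i \<noteq> j" for i j
        using injD[OF injs, of i j] that by (metis disjoint_iff)
      then show ?thesis by (auto simp: disjoint_family_on_def)
    qed
    define V where "V = {f :: nat \<Rightarrow> int. \<exists>m. \<forall>k\<ge>m. f k = 0}"
    \<comment> \<open>\<open>w \<xi>\<close> records the values of \<open>\<phi> \<xi>\<close> on
      all blocks; it is eventually zero, so only countably many rows occur.\<close>
    define w where "w \<xi> = (\<lambda>j. \<phi> \<xi> (ind (X j)))" for \<xi>
    have wV: "w \<xi> \<in> V" for \<xi>
      using additive_map_disjoint_family_eventually_zero[OF add disj] by (auto simp: w_def V_def)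
    \<comment> \<open>The summand \<open>nat\<close> makes the fibres infinite, in particular
      nonempty, even if \<open>C k\<close> is finite.\<close>
    have "\<exists>v\<in>V. |C k <+> (UNIV::nat set)| \<le>o |{\<xi> \<in> X k. w \<xi> = v}|" for k
    proof (rule large_fibre)
      show "|V| \<le>o |UNIV :: nat set|" unfolding V_def by (rule countable_finite_support)
      show "w ` X k \<subseteq> V" using wV by blast
      have inf: "infinite (X k)" using \<open>infinite (C (s k))\<close> X(2) card_of_ordIso_finite by blast
      have c: "|C k| <o |X k|" "|UNIV :: nat set| <o |X k|"
        using s(1)[of k] X(2)[of k] ordIso_symmetric ordLess_ordIso_trans by blast+
      show "|UNIV :: nat set| <o |X k|" by fact
      show "|C k <+> (UNIV::nat set)| <o |X k|" using inf c by (rule card_of_Plus_ordLess_infinite)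
    qed
    then obtain v where v: "\<And>k. |C k <+> (UNIV::nat set)| \<le>o |{\<xi> \<in> X k. w \<xi> = v k}|" by metis
    define Y where "Y k = {\<xi> \<in> X k. w \<xi> = v k}" for k
    have CY: "|C k| \<le>o |Y k|" for k
      using v[of k] card_of_Plus1 ordLeq_transitive unfolding Y_def by blast
    have infY: "infinite (Y k)" for k
      using v[of k] card_of_ordLeq_infinite unfolding Y_def
      by (metis finite_Plus_iff infinite_UNIV_nat)
    have "\<exists>x. \<forall>n. \<forall>\<xi>\<in>Y n. \<phi> \<xi> x \<noteq> 0"
    proof (rule exists_common_nonvanishing_sequence[OF add disj])
      show "Y n \<noteq> {}" for n using infY[of n] by auto
      show "\<phi> \<xi> (ind (X k)) = v n k" if "\<xi> \<in> Y n" for \<xi> n k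
      proof -
        have "w \<xi> = v n" using that by (simp add: Y_def)
        then show ?thesis by (metis w_def)
      qed
      show "v n n \<noteq> 0" for n
      proof -
        obtain \<xi> where "\<xi> \<in> Y n" using infY[of n] by (metis ex_in_conv finite.emptyI)
        then have "w \<xi> = v n" "\<phi> \<xi> (ind (X n)) \<noteq> 0" using X(3) by (auto simp: Y_def)
        then show ?thesis by (metis w_def)
      qed
    qed
    then obtain x where x: "\<And>n \<xi>. \<xi> \<in> Y n \<Longrightarrow> \<phi> \<xi> x \<noteq> 0" by blast
    have YU: "|Y n| \<le>o |\<Union>n. Y n|" for n by (rule card_of_mono1) blast
    \<comment> \<open>Every \<open>C k\<close>, not only those selected by \<open>s\<close>, is
      dominated by \<open>Y k\<close>; so the union of the \<open>Y n\<close> is as large as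
      \<open>D\<close>.\<close>
    have "|\<Union>n. C n| \<le>o |\<Union>n. Y n|"
    proof (rule card_of_UNION_nat_ordLeq)
      show "infinite (\<Union>n. Y n)" using infY[of 0] by (meson UNIV_I UN_upper finite_subset)
      show "|C n| \<le>o |\<Union>n. Y n|" for n using CY YU ordLeq_transitive by blast
    qed
    then have "|D| \<le>o |\<Union>n. Y n|" using D by simp
    moreover have "(\<Union>n. Y n) \<subseteq> D"
    proof (rule UN_least)
      have "Y n \<subseteq> X n" for n by (auto simp: Y_def)
      then show "Y n \<subseteq> D" for n using X(1) CD by (meson subset_trans)
    qed
    moreover have "\<forall>\<xi>\<in>\<Union>n. Y n. \<phi> \<xi> x \<noteq> 0" using x by (simp only: ball_UN) simp
    ultimately show ?thesis by (intro exI[of _ x] exI[of _ "\<Union>n. Y n"] conjI)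
  qed
qed

section \<open>Embeddings between the groups\<close>

lemma card_of_inj_image: "inj_on f A \<Longrightarrow> |f ` A| =o |A|"
  by (meson card_of_ordIsoI inj_on_imp_bij_betw ordIso_symmetric)

lemma embeds_trans:
  assumes "embeds G H" "embeds H I" shows "embeds G I"
proof -
  obtain f where f: "inj_on f G" "f ` G \<subseteq> H" "\<And>x y. x \<in> G \<Longrightarrow> y \<in> G \<Longrightarrow> f (x + y) = f x + f y"
    using assms(1) by (auto simp: embeds_def)
  obtain g where g: "inj_on g H" "g ` H \<subseteq> I" "\<And>x y. x \<in> H \<Longrightarrow> y \<in> H \<Longrightarrow> g (x + y) = g x + g y"
    using assms(2) by (auto simp: embeds_def)
  have "inj_on (g \<circ> f) G" using f g by (meson comp_inj_on inj_on_subset)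
  moreover have "(g \<circ> f) ` G \<subseteq> I" using f(2) g(2) by (auto simp: image_subset_iff)
  moreover have "(g \<circ> f) (x + y) = (g \<circ> f) x + (g \<circ> f) y" if "x \<in> G" "y \<in> G" for x y
    using f g that by (simp add: image_subset_iff)
  ultimately show ?thesis unfolding embeds_def by blast
qed

lemma embeds_P_mono:
  assumes KL: "|K| \<le>o |L|" and AB: "|A| \<le>o |B|"
  shows "embeds (P K A) (P L B)"
proof -
  obtain i where i: "inj_on i K" "i ` K \<subseteq> L" using KL unfolding card_of_ordLeq[symmetric] by blast
  define f where "f x = (\<lambda>\<eta>. if \<eta> \<in> i ` K then x (inv_into K i \<eta>) else 0)" for x :: "'a \<Rightarrow> int"
  have f_i: "f x (i \<xi>) = x \<xi>" if "\<xi> \<in> K" for x \<xi> using that i(1) by (simp add: f_def)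
  have "inj_on f (P K A)"
  proof (rule inj_onI)
    fix x y assume xy: "x \<in> P K A" "y \<in> P K A" and eq: "f x = f y"
    have "x \<xi> = y \<xi>" for \<xi>
      using xy f_i[of \<xi> x] f_i[of \<xi> y] eq by (cases "\<xi> \<in> K") (auto simp: P_def)
    then show "x = y" by blast
  qed
  moreover have "f x \<in> P L B" if x: "x \<in> P K A" for x
  proof -
    have "supp L (f x) \<subseteq> i ` supp K x" using i(1) by (auto simp: supp_def f_def split: if_splits)
    then have "|supp L (f x)| \<le>o |supp K x|" by (meson card_of_image card_of_mono1 ordLeq_transitive)
    also have "|supp K x| <o |A|" using x by (simp add: P_def)
    also have "|A| \<le>o |B|" by fact
    finally show ?thesis using i(2) by (auto simp: P_def f_def)
  qed
  moreover have "f (x + y) = f x + f y" for x y by (auto simp: f_def fun_eq_iff)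
  ultimately show ?thesis unfolding embeds_def by blast
qed

section \<open>Finite subsets and embeddings of groups of finitely supported functions\<close>

lemma card_of_Fpow_ordLeq:
  assumes M: "infinite M" shows "|Fpow M| \<le>o |M|"
proof -
  define F where "F n = {X. X \<subseteq> M \<and> finite X \<and> card X = n}" for n
  have "|F n| \<le>o |M|" for n
  proof (induction n)
    case 0
    have "F 0 = {{}}" by (auto simp: F_def)
    then show ?case using M finite_ordLess_card_of[of "F 0" M] ordLess_imp_ordLeq by auto
  next
    case (Suc n)
    have "F (Suc n) \<subseteq> (\<lambda>(a, X). insert a X) ` (M \<times> F n)"
    proof
      fix X assume X: "X \<in> F (Suc n)"
      then obtain a Y where "X = insert a Y" "a \<notin> Y" "card Y = n"
        using card_eq_SucD[of X n] by (auto simp: F_def)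
      then show "X \<in> (\<lambda>(a, X). insert a X) ` (M \<times> F n)"
        using X by (intro image_eqI[of _ _ "(a, Y)"]) (auto simp: F_def)
    qed
    then have "|F (Suc n)| \<le>o |M \<times> F n|" by (meson card_of_image card_of_mono1 ordLeq_transitive)
    also have "|M \<times> F n| \<le>o |M|"
      using M Suc by (intro card_of_Sigma_ordLeq_infinite) (auto intro: card_of_mono1)
    finally show ?case .
  qed
  then have "|\<Union>n. F n| \<le>o |M|"
    by (rule card_of_UNION_nat_ordLeq[OF M])
  moreover have "Fpow M = (\<Union>n. F n)" by (auto simp: F_def Fpow_def)
  ultimately show ?thesis by simp
qed

lemma card_of_Fpow_ordLess:
  assumes "infinite B" "|S| <o |B|" shows "|Fpow S| <o |B|"
proof (cases "finite S")
  case True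
  then have "finite (Fpow S)" by (auto simp: Fpow_def)
  then show ?thesis using assms(1) by (rule finite_ordLess_card_of)
next
  case False
  then show ?thesis using assms(2) card_of_Fpow_ordLeq ordLeq_ordLess_trans by blast
qed

lemma card_of_finite_UNION_ordLess:
  assumes "infinite B" "finite I" "\<And>i. i \<in> I \<Longrightarrow> |S i| <o |B|" shows "|\<Union>i\<in>I. S i| <o |B|"
  using assms(2,3)
proof (induction I)
  case empty
  then show ?case using finite_ordLess_card_of[OF finite.emptyI assms(1)] by simp
next
  case (insert i I)
  then show ?case using card_of_Un_ordLess_infinite[OF assms(1), of "S i" "\<Union>i\<in>I. S i"] by simp
qed

text \<open>The indicators of \<open>Fpow (h \<xi>)\<close> are linearly independent: for a maximal \<open>h \<xi>\<close> among finitely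
  many distinct sets, some finite subset of \<open>h \<xi>\<close> is contained in none of the others.\<close>

lemma embeds_finite_support:
  fixes K :: "'a set" and h :: "'a \<Rightarrow> 'e set"
  assumes A: "|A| =o |UNIV :: nat set|" and B: "infinite B"
    and inj: "inj_on h K" and h: "\<And>\<xi>. \<xi> \<in> K \<Longrightarrow> h \<xi> \<subseteq> M \<and> |h \<xi>| <o |B|"
  shows "embeds (P K A) (P (Fpow M) B)"
proof -
  have fin: "finite (supp K x)" if "x \<in> P K A" for x
  proof -
    have "|supp K x| <o |UNIV :: nat set|" using that A ordLess_ordIso_trans by (auto simp: P_def)
    then show ?thesis using infinite_iff_card_of_nat not_ordLess_ordLeq by blast
  qed
  \<comment> \<open>For \<open>F\<close> in \<open>Fpow M\<close>,
    \<open>F \<subseteq> h \<xi>\<close> means that \<open>F\<close> lies in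
    \<open>Fpow (h \<xi>)\<close>; so \<open>f\<close> sends the unit vector at \<open>\<xi>\<close>
    in \<open>K\<close> to the indicator of \<open>Fpow (h \<xi>)\<close>.\<close>
  define f where "f x = (\<lambda>F. if F \<in> Fpow M then \<Sum>\<xi>\<in>supp K x. if F \<subseteq> h \<xi> then x \<xi> else 0 else 0)"
    for x :: "'a \<Rightarrow> int"
  have f_eq: "f x F = (\<Sum>\<xi>\<in>T. if F \<subseteq> h \<xi> then x \<xi> else 0)"
    if "finite T" "supp K x \<subseteq> T" "T \<subseteq> K" "F \<in> Fpow M" for x T F
  proof -
    have "(\<Sum>\<xi>\<in>supp K x. if F \<subseteq> h \<xi> then x \<xi> else 0) = (\<Sum>\<xi>\<in>T. if F \<subseteq> h \<xi> then x \<xi> else 0)"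
      using that by (intro sum.mono_neutral_left) (auto simp: supp_def)
    then show ?thesis using that(4) by (simp add: f_def)
  qed
  have "f (x + y) = f x + f y" if x: "x \<in> P K A" and y: "y \<in> P K A" for x y
  proof
    fix F
    let ?T = "supp K x \<union> supp K y"
    have T: "finite ?T" "?T \<subseteq> K" "supp K (x + y) \<subseteq> ?T" using fin x y by (auto simp: supp_def)
    show "f (x + y) F = (f x + f y) F"
    proof (cases "F \<in> Fpow M")
      case True
      have "f (x + y) F = (\<Sum>\<xi>\<in>?T. (if F \<subseteq> h \<xi> then x \<xi> else 0) + (if F \<subseteq> h \<xi> then y \<xi> else 0))"
        unfolding f_eq[OF T(1,3,2) True] by (intro sum.cong) auto
      also have "\<dots> = f x F + f y F"
        unfolding sum.distrib using f_eq[OF T(1) _ T(2) True, of x] f_eq[OF T(1) _ T(2) True, of y] by simp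
      finally show ?thesis by simp
    qed (simp add: f_def)
  qed
  moreover have "inj_on f (P K A)"
  proof (rule inj_onI, rule ccontr)
    fix x y assume x: "x \<in> P K A" and y: "y \<in> P K A" and eq: "f x = f y" and "x \<noteq> y"
    define T where "T = {\<xi> \<in> supp K x \<union> supp K y. x \<xi> \<noteq> y \<xi>}"
    have finT: "finite T" using fin x y by (simp add: T_def)
    have TK: "T \<subseteq> K" by (auto simp: T_def supp_def)
    obtain \<xi>0 where \<xi>0: "x \<xi>0 \<noteq> y \<xi>0" using \<open>x \<noteq> y\<close> by blast
    have "\<xi>0 \<in> K" by (rule ccontr) (use \<xi>0 x y in \<open>auto simp: P_def\<close>)
    then have "T \<noteq> {}" using \<xi>0 by (auto simp: T_def supp_def)
    then have "\<exists>S\<in>h ` T. \<forall>S'\<in>h ` T. S \<le> S' \<longrightarrow> S = S'"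
      using finT by (intro finite_has_maximal) auto
    then obtain \<xi> where \<xi>: "\<xi> \<in> T" "\<And>\<xi>'. \<xi>' \<in> T \<Longrightarrow> h \<xi> \<subseteq> h \<xi>' \<Longrightarrow> h \<xi> = h \<xi>'" by auto
    then have "\<forall>\<xi>'\<in>T - {\<xi>}. \<exists>p. p \<in> h \<xi> \<and> p \<notin> h \<xi>'"
      using inj TK by (metis DiffE inj_onD insertI1 subsetD subsetI)
    then obtain p where p: "\<And>\<xi>'. \<xi>' \<in> T - {\<xi>} \<Longrightarrow> p \<xi>' \<in> h \<xi> \<and> p \<xi>' \<notin> h \<xi>'" by metis
    define F where "F = p ` (T - {\<xi>})"
    have F: "F \<in> Fpow M" "F \<subseteq> h \<xi>" using p finT h[of \<xi>] \<xi>(1) TK by (auto simp: F_def Fpow_def)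
    have nF: "\<not> F \<subseteq> h \<xi>'" if "\<xi>' \<in> T - {\<xi>}" for \<xi>' using p that by (auto simp: F_def)
    let ?U = "supp K x \<union> supp K y"
    have U: "finite ?U" "?U \<subseteq> K" using fin x y by (auto simp: supp_def)
    have "0 = f x F - f y F" using eq by simp
    also have "\<dots> = (\<Sum>\<xi>'\<in>?U. (if F \<subseteq> h \<xi>' then x \<xi>' else 0) - (if F \<subseteq> h \<xi>' then y \<xi>' else 0))"
      unfolding sum_subtractf using f_eq[OF U(1) _ U(2) F(1), of x] f_eq[OF U(1) _ U(2) F(1), of y] by simp
    \<comment> \<open>At \<open>F\<close> every index other than \<open>\<xi>\<close> drops out:
      outside \<open>T\<close> the functions agree, and for the others in \<open>T\<close> the set
      \<open>h \<xi>'\<close> does not contain \<open>F\<close>.\<close>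
    also have "\<dots> = (\<Sum>\<xi>'\<in>{\<xi>}. (if F \<subseteq> h \<xi>' then x \<xi>' else 0) - (if F \<subseteq> h \<xi>' then y \<xi>' else 0))"
      using U(1) \<xi>(1) nF by (intro sum.mono_neutral_right) (auto simp: T_def)
    also have "\<dots> = x \<xi> - y \<xi>" using F(2) by simp
    finally show False using \<xi>(1) by (simp add: T_def)
  qed
  moreover have "f x \<in> P (Fpow M) B" if x: "x \<in> P K A" for x
  proof -
    have "supp (Fpow M) (f x) \<subseteq> (\<Union>\<xi>\<in>supp K x. Fpow (h \<xi>))"
    proof
      fix F assume F: "F \<in> supp (Fpow M) (f x)"
      then have "(\<Sum>\<xi>\<in>supp K x. if F \<subseteq> h \<xi> then x \<xi> else 0) \<noteq> 0" by (auto simp: supp_def f_def)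
      then obtain \<xi> where "\<xi> \<in> supp K x" "(if F \<subseteq> h \<xi> then x \<xi> else 0) \<noteq> 0"
        by (rule sum.not_neutral_contains_not_neutral)
      then show "F \<in> (\<Union>\<xi>\<in>supp K x. Fpow (h \<xi>))"
        using F by (auto simp: supp_def Fpow_def split: if_splits)
    qed
    then have "|supp (Fpow M) (f x)| \<le>o |\<Union>\<xi>\<in>supp K x. Fpow (h \<xi>)|" by (rule card_of_mono1)
    also have "|\<Union>\<xi>\<in>supp K x. Fpow (h \<xi>)| <o |B|"
      by (rule card_of_finite_UNION_ordLess[OF B fin[OF x]])
         (use h in \<open>auto simp: supp_def intro: card_of_Fpow_ordLess[OF B]\<close>)
    finally show ?thesis by (auto simp: P_def f_def)
  qed
  ultimately show ?thesis unfolding embeds_def by blast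
qed

section \<open>Cardinals below \<open>|B|\<close> and the size of \<open>P L B\<close>\<close>

lemma cardinal_below_eqI:
  assumes b: "b \<in> cardinal_below B" "b' \<in> cardinal_below B"
    and eq: "card_of (underS (card_of B) b) =o card_of (underS (card_of B) b')"
  shows "b = b'"
proof (rule ccontr)
  assume "b \<noteq> b'"
  have "total_on B (card_of B)"
    using card_of_Well_order[of B] by (simp add: well_order_on_def linear_order_on_def Field_card_of)
  then have "(b, b') \<in> card_of B \<or> (b', b) \<in> card_of B"
    using b \<open>b \<noteq> b'\<close> by (auto simp: total_on_def cardinal_below_def)
  then show False
    using b eq \<open>b \<noteq> b'\<close> not_ordLess_ordIso ordIso_symmetric by (fastforce simp: cardinal_below_def)
qed

text \<open>The size of \<open>S\<close> is that of some proper initial segment of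
  \<open>|B|\<close>; the least such segment is a cardinal, since all shorter ones are strictly
  smaller.\<close>

lemma exists_cardinal_below:
  fixes S :: "'e set" and B :: "'d set"
  assumes "|S| <o |B|"
  shows "\<exists>b\<in>cardinal_below B. card_of (underS (card_of B) b) =o |S|"
proof -
  let ?r = "card_of B"
  have wo: "Well_order ?r" by (rule card_of_Well_order)
  define Q where "Q = {b \<in> B. card_of (underS ?r b) =o |S|}"
  have "\<exists>a\<in>Field ?r. |S| =o Restr ?r (underS ?r a)"
    using assms ordLess_iff_ordIso_Restr[OF wo card_of_Well_order] by blast
  then obtain a where a: "a \<in> B" "|S| =o Restr ?r (underS ?r a)" by (auto simp: Field_card_of)
  have "Field (Restr ?r (underS ?r a)) = underS ?r a"
    using wo by (intro Refl_Field_Restr2)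
      (auto simp: well_order_on_def linear_order_on_def partial_order_on_def preorder_on_def
        intro: underS_Field)
  then have "card_of S =o card_of (underS ?r a)"
    using card_of_cong[OF a(2)] by (simp add: Field_card_of)
  then have "a \<in> Q" using a(1) ordIso_symmetric by (auto simp: Q_def)
  have "wf (?r - Id)" using wo by (simp add: well_order_on_def)
  then obtain b where b: "b \<in> Q" "\<And>b'. (b', b) \<in> ?r - Id \<Longrightarrow> b' \<notin> Q"
    using \<open>a \<in> Q\<close> by (metis wfE_min)
  have "card_of (underS ?r b') <o card_of (underS ?r b)" if b': "(b', b) \<in> ?r" "b' \<noteq> b" for b'
  proof -
    have "underS ?r b' \<subseteq> underS ?r b"
      using wo b' by (intro underS_incr)
        (auto simp: well_order_on_def linear_order_on_def partial_order_on_def preorder_on_def)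
    then have le: "card_of (underS ?r b') \<le>o card_of (underS ?r b)" by (rule card_of_mono1)
    have "b' \<in> B" using b'(1) by (metis FieldI1 Field_card_of)
    then have "\<not> card_of (underS ?r b') =o card_of (underS ?r b)"
      using b b' ordIso_transitive by (fastforce simp: Q_def)
    then show ?thesis using le ordLeq_iff_ordLess_or_ordIso by blast
  qed
  then have "b \<in> cardinal_below B" using b(1) by (auto simp: cardinal_below_def Q_def)
  then show ?thesis using b(1) by (auto simp: Q_def)
qed

text \<open>A domain below \<open>|B|\<close> has size at most \<open>|L|\<close>, so an injection
  moves it into \<open>L\<close>, and the function is coded by its graph. The size of the graph
  recovers the domain, as \<open>cardinal_below B\<close> contains each cardinal only once.\<close>

lemma card_of_pow_less_ordLeq_small_subsets:
  fixes L :: "'b set" and B :: "'d set"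
  assumes BL: "|B| \<le>o cardSuc |L|"
  shows "|pow_less L B| \<le>o |{S. S \<subseteq> L \<times> L \<and> |S| <o |B|}|"
proof -
  let ?D = "\<lambda>b. underS (card_of B) b"
  have small: "card_of (?D b) <o |B|" if "b \<in> B" for b
    using card_of_underS[OF card_of_Card_order] that by (simp add: Field_card_of)
  have "\<exists>i. inj_on i (?D b) \<and> i ` ?D b \<subseteq> L" if "b \<in> B" for b
  proof -
    have "card_of (?D b) <o cardSuc |L|" using small[OF that] BL ordLess_ordLeq_trans by blast
    then have "card_of (?D b) \<le>o |L|" using cardSuc_ordLeq_ordLess[OF card_of_Card_order card_of_Card_order] by blast
    then show ?thesis by (simp add: card_of_ordLeq)
  qed
  then obtain i where i: "\<And>b. b \<in> B \<Longrightarrow> inj_on (i b) (?D b)" "\<And>b. b \<in> B \<Longrightarrow> i b ` ?D b \<subseteq> L" by metis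
  define g where "g = (\<lambda>(b, f :: 'd \<Rightarrow> 'b). (\<lambda>x. (i b x, f x)) ` ?D b)"
  have cB: "b \<in> B" if "b \<in> cardinal_below B" for b using that by (simp add: cardinal_below_def)
  have card_g: "card_of (g (b, f)) =o card_of (?D b)" if "b \<in> B" for b f
  proof -
    have "inj_on (\<lambda>x. (i b x, f x)) (?D b)" using i(1)[OF that] by (auto simp: inj_on_def)
    then show ?thesis unfolding g_def by (simp add: card_of_inj_image)
  qed
  have "inj_on g (pow_less L B)"
  proof (rule inj_onI)
    fix u u' assume u: "u \<in> pow_less L B" "u' \<in> pow_less L B" and eq: "g u = g u'"
    obtain b f b' f' where bf: "u = (b, f)" "u' = (b', f')" by fastforce
    have b: "b \<in> cardinal_below B" "b' \<in> cardinal_below B" and f: "f \<in> Func (?D b) L" "f' \<in> Func (?D b') L"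
      using u by (auto simp: bf pow_less_def)
    have "card_of (?D b) =o card_of (?D b')"
      using card_g[OF cB[OF b(1)], of f] card_g[OF cB[OF b(2)], of f'] eq bf
      by (metis ordIso_symmetric ordIso_transitive)
    then have bb: "b = b'" using cardinal_below_eqI[OF b] by blast
    have "f x = f' x" for x
    proof (cases "x \<in> ?D b")
      case True
      then have "(i b x, f x) \<in> g u'" using eq by (auto simp: bf g_def)
      then obtain x' where "x' \<in> ?D b" "i b x = i b x'" "f x = f' x'" by (auto simp: bf g_def bb)
      then show ?thesis using i(1)[OF cB[OF b(1)]] True by (metis inj_onD)
    next
      case False
      then show ?thesis using f bb by (auto simp: Func_def)
    qed
    then show "u = u'" using bb bf by auto
  qed
  moreover have "g ` pow_less L B \<subseteq> {S. S \<subseteq> L \<times> L \<and> |S| <o |B|}"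
  proof
    fix S assume "S \<in> g ` pow_less L B"
    then obtain b f where bf: "b \<in> cardinal_below B" "f \<in> Func (?D b) L" "S = g (b, f)"
      by (auto simp: pow_less_def)
    have "S \<subseteq> L \<times> L" using bf(2,3) i(2)[OF cB[OF bf(1)]] by (auto simp: g_def Func_def)
    moreover have "|S| <o |B|"
      using card_g[OF cB[OF bf(1)]] small[OF cB[OF bf(1)]] bf(3) ordIso_ordLess_trans by blast
    ultimately show "S \<in> {S. S \<subseteq> L \<times> L \<and> |S| <o |B|}" by blast
  qed
  ultimately show ?thesis unfolding card_of_ordLeq[symmetric] by blast
qed

text \<open>List the graph of \<open>y\<close> over its support along the cardinal of that support,
  with pairs from \<open>L\<close> and the integers coded in \<open>L\<close>.\<close>

lemma card_of_P_ordLeq_pow_less: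
  fixes L :: "'b set" and B :: "'d set"
  assumes L: "infinite L"
  shows "|P L B| \<le>o |pow_less L B|"
proof -
  let ?D = "\<lambda>b. underS (card_of B) b"
  have "|UNIV :: int set| \<le>o |UNIV :: nat set|"
    using card_of_ordLeq[of "UNIV :: int set" "UNIV :: nat set"] inj_to_nat by blast
  then have "|UNIV :: int set| \<le>o |L|" using L infinite_iff_card_of_nat ordLeq_transitive by blast
  then have "|L \<times> (UNIV :: int set)| \<le>o |L|"
    using L by (intro card_of_Sigma_ordLeq_infinite) (auto intro: card_of_mono1)
  then obtain c where c: "inj_on c (L \<times> (UNIV :: int set))" "c ` (L \<times> UNIV) \<subseteq> L"
    unfolding card_of_ordLeq[symmetric] by blast
  have "\<exists>b e. b \<in> cardinal_below B \<and> bij_betw e (?D b) (supp L y)" if "y \<in> P L B" for y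
    using exists_cardinal_below[of "supp L y" B] that unfolding card_of_ordIso[symmetric] by (auto simp: P_def)
  then obtain b e where be: "\<And>y. y \<in> P L B \<Longrightarrow> b y \<in> cardinal_below B"
      "\<And>y. y \<in> P L B \<Longrightarrow> bij_betw (e y) (?D (b y)) (supp L y)"
    by metis
  define g where "g y = (b y, \<lambda>x. if x \<in> ?D (b y) then c (e y x, y (e y x)) else undefined)" for y
  have e: "e y ` ?D (b y) = supp L y" if "y \<in> P L B" for y using be(2)[OF that] by (simp add: bij_betw_def)
  \<comment> \<open>The set of listed values does not depend on the chosen enumeration: it is the
    coded graph over the support, which determines \<open>y\<close>.\<close>
  have graph: "snd (g y) ` ?D (fst (g y)) = c ` (\<lambda>\<xi>. (\<xi>, y \<xi>)) ` supp L y" if "y \<in> P L B" for y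
    unfolding e[OF that, symmetric] by (auto simp: g_def image_image)
  have "inj_on g (P L B)"
  proof (rule inj_onI)
    fix y z assume y: "y \<in> P L B" and z: "z \<in> P L B" and eq: "g y = g z"
    have "c ` (\<lambda>\<xi>. (\<xi>, y \<xi>)) ` supp L y = c ` (\<lambda>\<xi>. (\<xi>, z \<xi>)) ` supp L z"
      using graph[OF y] graph[OF z] eq by simp
    then have eqg: "(\<lambda>\<xi>. (\<xi>, y \<xi>)) ` supp L y = (\<lambda>\<xi>. (\<xi>, z \<xi>)) ` supp L z"
      by (subst (asm) inj_on_image_eq_iff[OF c(1)]) (auto simp: supp_def)
    have "y \<xi> = z \<xi>" for \<xi>
    proof (cases "\<xi> \<in> supp L y \<or> \<xi> \<in> supp L z")
      case True
      then have "(\<xi>, y \<xi>) \<in> (\<lambda>\<xi>. (\<xi>, z \<xi>)) ` supp L z \<or> (\<xi>, z \<xi>) \<in> (\<lambda>\<xi>. (\<xi>, y \<xi>)) ` supp L y"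
        using eqg by blast
      then show ?thesis by auto
    next
      case False
      then show ?thesis using y z by (auto simp: P_def supp_def)
    qed
    then show "y = z" by blast
  qed
  moreover have "g y \<in> pow_less L B" if "y \<in> P L B" for y
  proof -
    have "e y x \<in> L" if "x \<in> ?D (b y)" for x
      using e[OF \<open>y \<in> P L B\<close>] that by (auto simp: supp_def)
    then show ?thesis using be(1)[OF that] c(2) by (auto simp: g_def pow_less_def Func_def)
  qed
  ultimately show ?thesis unfolding card_of_ordLeq[symmetric] by blast
qed

section \<open>Necessary conditions for an embedding\<close>

lemma restrict_in_P:
  assumes "D \<subseteq> K" "|D| <o |A|" shows "(\<lambda>\<xi>. if \<xi> \<in> D then x \<xi> else 0) \<in> P K A"
proof -
  have "supp K (\<lambda>\<xi>. if \<xi> \<in> D then x \<xi> else 0) \<subseteq> D" by (auto simp: supp_def)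
  then have "|supp K (\<lambda>\<xi>. if \<xi> \<in> D then x \<xi> else 0)| <o |A|"
    using assms(2) card_of_mono1 ordLeq_ordLess_trans by blast
  then show ?thesis using assms(1) by (auto simp: P_def)
qed

lemma ind_singleton_in_P:
  assumes "infinite A" "\<xi> \<in> K" shows "ind {\<xi>} \<in> P K A"
  using restrict_in_P[of "{\<xi>}" K A "\<lambda>_. 1"] assms finite_ordLess_card_of[of "{\<xi>}" A]
  by (simp add: ind_def)

lemma embeds_imp_ordLeq_pow_less:
  fixes K :: "'a set" and L :: "'b set" and A :: "'c set" and B :: "'d set"
  assumes "infinite L" "infinite A" "embeds (P K A) (P L B)"
  shows "|K| \<le>o |pow_less L B|"
proof -
  obtain f where f: "inj_on f (P K A)" "f ` P K A \<subseteq> P L B" using assms(3) by (auto simp: embeds_def)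
  have "inj_on (\<lambda>\<xi>. ind {\<xi>} :: 'a \<Rightarrow> int) K"
    by (rule inj_onI) (auto simp: ind_def fun_eq_iff split: if_splits)
  moreover have "(\<lambda>\<xi>. ind {\<xi>}) ` K \<subseteq> P K A"
    using ind_singleton_in_P[OF assms(2)] by (rule image_subsetI)
  ultimately have "|K| \<le>o |P K A|" unfolding card_of_ordLeq[symmetric] by blast
  also have "|P K A| \<le>o |P L B|" using f unfolding card_of_ordLeq[symmetric] by blast
  also have "|P L B| \<le>o |pow_less L B|" by (rule card_of_P_ordLeq_pow_less[OF assms(1)])
  finally show ?thesis .
qed

lemma card_of_finite_to_one:
  assumes "infinite X" "\<And>\<eta>. finite {\<xi> \<in> X. \<eta> = g \<xi>}"
  shows "|X| \<le>o |g ` X|"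
proof -
  have "X = (\<Union>\<eta>\<in>g ` X. {\<xi> \<in> X. \<eta> = g \<xi>})" by blast
  then have inf: "infinite (g ` X)" using assms by (metis (no_types, lifting) finite_UN_I)
  have "|\<Union>\<eta>\<in>g ` X. {\<xi> \<in> X. \<eta> = g \<xi>}| \<le>o |g ` X|"
  proof (rule card_of_UNION_ordLeq_infinite[OF inf])
    show "|g ` X| \<le>o |g ` X|" by (rule card_of_mono1) simp
    show "\<forall>\<eta>\<in>g ` X. |{\<xi> \<in> X. \<eta> = g \<xi>}| \<le>o |g ` X|"
      using finite_ordLess_card_of[OF assms(2) inf] ordLess_imp_ordLeq by blast
  qed
  then show ?thesis using \<open>X = _\<close> by simp
qed

lemma embeds_uncountable_imp:
  fixes K :: "'a set" and L :: "'b set" and A :: "'c set" and B :: "'d set"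
  assumes K: "infinite K" and B: "infinite B"
    and A: "|UNIV :: nat set| <o |A|" "|A| \<le>o cardSuc |K|"
    and emb: "embeds (P K A) (P L B)"
  shows "|K| \<le>o |L| \<and> |A| \<le>o |B|"
proof -
  obtain f where inj: "inj_on f (P K A)" and img: "\<And>x. x \<in> P K A \<Longrightarrow> f x \<in> P L B"
    and add: "\<And>x y. x \<in> P K A \<Longrightarrow> y \<in> P K A \<Longrightarrow> f (x + y) = f x + f y"
    using emb by (auto simp: embeds_def)
  have infA: "infinite A" using A(1) by (meson card_of_ordLeq_infinite infinite_UNIV_nat ordLess_imp_ordLeq)
  note unit = ind_singleton_in_P[OF infA, where K=K]
  \<comment> \<open>Restricting to a set \<open>D\<close> smaller than \<open>A\<close> puts every
    function into \<open>P K A\<close>, so the coordinates of \<open>f\<close> become homomorphisms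
    on all functions.\<close>
  define F where "F D x = f (\<lambda>\<xi>. if \<xi> \<in> D then x \<xi> else 0)" for D x
  have F_add: "additive_map (\<lambda>x. F D x \<eta>)" if "D \<subseteq> K" "|D| <o |A|" for D \<eta>
    unfolding additive_map_def
  proof (intro allI)
    fix x y :: "'a \<Rightarrow> int"
    have "(\<lambda>\<xi>. if \<xi> \<in> D then (x + y) \<xi> else 0) =
      (\<lambda>\<xi>. if \<xi> \<in> D then x \<xi> else 0) + (\<lambda>\<xi>. if \<xi> \<in> D then y \<xi> else 0)" by auto
    then show "F D (x + y) \<eta> = F D x \<eta> + F D y \<eta>"
      unfolding F_def using add restrict_in_P[OF that] by simp
  qed
  have F_unit: "F D (ind {\<xi>}) = f (ind {\<xi>})" if "\<xi> \<in> D" for D \<xi>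
  proof -
    have "(\<lambda>\<zeta>. if \<zeta> \<in> D then ind {\<xi>} \<zeta> else 0) = ind {\<xi>}" using that by (auto simp: ind_def)
    then show ?thesis by (simp add: F_def)
  qed
  have fin: "finite {\<xi> \<in> K. f (ind {\<xi>}) \<eta> \<noteq> 0}" for \<eta>
  proof (rule ccontr)
    assume "infinite {\<xi> \<in> K. f (ind {\<xi>}) \<eta> \<noteq> 0}"
    then obtain s :: "nat \<Rightarrow> 'a" where s: "inj s" "range s \<subseteq> {\<xi> \<in> K. f (ind {\<xi>}) \<eta> \<noteq> 0}"
      using infinite_countable_subset by blast
    \<comment> \<open>Uncountability of \<open>A\<close> enters here: arbitrary functions supported
      on \<open>range s\<close> lie in \<open>P K A\<close>.\<close>
    have "|range s| <o |A|" using card_of_image A(1) by (rule ordLeq_ordLess_trans)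
    then have "finite {\<xi>. F (range s) (ind {\<xi>}) \<eta> \<noteq> 0}"
      using s(2) by (intro additive_map_finite_support F_add) auto
    moreover have "range s \<subseteq> {\<xi>. F (range s) (ind {\<xi>}) \<eta> \<noteq> 0}" using s(2) by (auto simp: F_unit)
    ultimately have "finite (range s)" by (rule rev_finite_subset)
    then show False using s(1) by (simp add: finite_image_iff)
  qed
  have "\<exists>\<eta>\<in>L. f (ind {\<xi>}) \<eta> \<noteq> 0" if \<xi>: "\<xi> \<in> K" for \<xi>
  proof -
    have z: "(0 :: 'a \<Rightarrow> int) \<in> P K A"
      using restrict_in_P[of "{}" K A] finite_ordLess_card_of[OF finite.emptyI infA] by (simp add: zero_fun_def)
    have "f 0 = 0" using add[OF z z] by simp
    moreover have "ind {\<xi>} \<noteq> 0" by (auto simp: ind_def fun_eq_iff)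
    ultimately have "f (ind {\<xi>}) \<noteq> 0" using inj_onD[OF inj _ unit[OF \<xi>] z] by metis
    then obtain \<eta> where \<eta>: "f (ind {\<xi>}) \<eta> \<noteq> 0" by (auto simp: fun_eq_iff)
    moreover have "\<eta> \<in> L" by (rule ccontr) (use \<eta> img[OF unit[OF \<xi>]] in \<open>auto simp: P_def\<close>)
    ultimately show ?thesis by blast
  qed
  \<comment> \<open>By \<open>fin\<close>, this choice of a coordinate for each index is
    finite-to-one, so \<open>g\<close> preserves the size of infinite sets.\<close>
  then obtain g where g: "\<And>\<xi>. \<xi> \<in> K \<Longrightarrow> g \<xi> \<in> L" "\<And>\<xi>. \<xi> \<in> K \<Longrightarrow> f (ind {\<xi>}) (g \<xi>) \<noteq> 0" by metis
  have g_large: "|X| \<le>o |g ` X|" if "X \<subseteq> K" "infinite X" for X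
  proof (rule card_of_finite_to_one[OF that(2)])
    show "finite {\<xi> \<in> X. \<eta> = g \<xi>}" for \<eta>
      by (rule finite_subset[OF _ fin[of \<eta>]]) (use g(2) that(1) in auto)
  qed
  have "|K| \<le>o |L|"
    using g_large[OF subset_refl K] card_of_mono1[of "g ` K" L] g(1) ordLeq_transitive by blast
  moreover have "|A| \<le>o |B|"
  proof (rule ccontr)
    assume "\<not> |A| \<le>o |B|"
    then have BA: "|B| <o |A|" by (meson card_of_Well_order ordLess_or_ordLeq)
    \<comment> \<open>So \<open>K\<close> contains a set of size \<open>|B|\<close>, and arbitrary
      functions supported on it lie in \<open>P K A\<close>.\<close>
    then have "|B| <o cardSuc |K|" using A(2) by (rule ordLess_ordLeq_trans)
    then have "|B| \<le>o |K|" using cardSuc_ordLeq_ordLess[OF card_of_Card_order card_of_Card_order] by blast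
    then obtain i where i: "inj_on i B" "i ` B \<subseteq> K" unfolding card_of_ordLeq[symmetric] by blast
    define D where "D = i ` B"
    have DB: "|D| =o |B|" unfolding D_def by (rule card_of_inj_image[OF i(1)])
    have DA: "|D| <o |A|" using DB BA by (rule ordIso_ordLess_trans)
    have DK: "D \<subseteq> K" using i(2) by (simp add: D_def)
    have infD: "infinite D" unfolding D_def using B i(1) by (simp add: finite_image_iff)
    \<comment> \<open>The functional for \<open>\<xi>\<close> is the coordinate
      \<open>g \<xi>\<close> of \<open>F D\<close>. The image of \<open>Y\<close> under
      \<open>g\<close> will lie in the support of \<open>F D x\<close> and have size at least
      \<open>|B|\<close>, too large for an element of \<open>P L B\<close>.\<close>
    have "\<exists>x. \<exists>Y\<subseteq>D. |D| \<le>o |Y| \<and> (\<forall>\<xi>\<in>Y. F D x (g \<xi>) \<noteq> 0)"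
      by (rule large_common_nonvanishing[OF infD F_add[OF DK DA]]) (use g(2) DK F_unit in auto)
    then obtain x Y where Y: "Y \<subseteq> D" "|D| \<le>o |Y|" "\<forall>\<xi>\<in>Y. F D x (g \<xi>) \<noteq> 0" by blast
    have YK: "Y \<subseteq> K" using Y(1) DK by blast
    have "|D| \<le>o |Y|" by fact
    also have "|Y| \<le>o |g ` Y|"
      using g_large[OF YK] Y(2) infD card_of_ordLeq_infinite by blast
    also have "|g ` Y| \<le>o |supp L (F D x)|"
      using Y(3) g(1) YK by (intro card_of_mono1) (auto simp: supp_def)
    also have "|supp L (F D x)| <o |B|"
      using img[OF restrict_in_P[OF DK DA]] by (simp add: P_def F_def)
    finally have "|D| <o |B|" .
    then show False using DB not_ordLess_ordIso by blast
  qed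
  ultimately show ?thesis by blast
qed

theorem theorem1:
  fixes K :: "'a set" and L :: "'b set" and A :: "'c set" and B :: "'d set"
  assumes "infinite K" and "infinite L"
    and "infinite A" and "card_le_succ A K"
    and "infinite B" and "card_le_succ B L"
  shows "embeds (P K A) (P L B) \<longleftrightarrow>
           ((card_le K L \<and> card_le A B) \<or> (card_le K (pow_less L B) \<and> card_is_omega A))"
proof
  assume emb: "embeds (P K A) (P L B)"
  show "(card_le K L \<and> card_le A B) \<or> (card_le K (pow_less L B) \<and> card_is_omega A)"
  proof (cases "card_is_omega A")
    case True
    then show ?thesis
      using embeds_imp_ordLeq_pow_less[OF assms(2,3) emb] by (simp add: card_le_def)
  next
    case False
    have "|UNIV :: nat set| \<le>o |A|" using assms(3) infinite_iff_card_of_nat by blast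
    moreover have "\<not> |UNIV :: nat set| =o |A|"
      using False ordIso_symmetric unfolding card_is_omega_def by blast
    ultimately have "|UNIV :: nat set| <o |A|" using ordLeq_iff_ordLess_or_ordIso by blast
    moreover have "|A| \<le>o cardSuc |K|" using assms(4) by (simp add: card_le_succ_def)
    ultimately show ?thesis
      using embeds_uncountable_imp[OF assms(1,5) _ _ emb] by (simp add: card_le_def)
  qed
next
  assume "(card_le K L \<and> card_le A B) \<or> (card_le K (pow_less L B) \<and> card_is_omega A)"
  then show "embeds (P K A) (P L B)"
  proof
    assume "card_le K L \<and> card_le A B"
    then show ?thesis using embeds_P_mono by (auto simp: card_le_def)
  next
    assume *: "card_le K (pow_less L B) \<and> card_is_omega A"
    \<comment> \<open>Small subsets of \<open>L \<times> L\<close> supply the sets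
      \<open>h \<xi>\<close>; the index set \<open>Fpow (L \<times> L)\<close> is no larger than
      \<open>L\<close>, so the target can be moved into \<open>P L B\<close>.\<close>
    then have "|K| \<le>o |pow_less L B|" by (simp add: card_le_def)
    also have "|pow_less L B| \<le>o |{S. S \<subseteq> L \<times> L \<and> |S| <o |B|}|"
      using assms(6) by (intro card_of_pow_less_ordLeq_small_subsets) (simp add: card_le_succ_def)
    finally obtain h where h: "inj_on h K" "h ` K \<subseteq> {S. S \<subseteq> L \<times> L \<and> |S| <o |B|}"
      unfolding card_of_ordLeq[symmetric] by blast
    have "embeds (P K A) (P (Fpow (L \<times> L)) B)"
      by (rule embeds_finite_support[OF _ assms(5) h(1)])
         (use * h(2) in \<open>auto simp: card_is_omega_def\<close>)
    moreover have "embeds (P (Fpow (L \<times> L)) B) (P L B)"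
    proof (rule embeds_P_mono)
      have "|Fpow (L \<times> L)| \<le>o |L \<times> L|" 
        using assms(2) by (intro card_of_Fpow_ordLeq) (auto simp: finite_cartesian_product_iff)
      also have "|L \<times> L| =o |L|" using assms(2) by (rule card_of_Times_same_infinite)
      finally show "|Fpow (L \<times> L)| \<le>o |L|" .
      show "|B| \<le>o |B|" by (rule card_of_mono1) simp
    qed
    ultimately show ?thesis by (rule embeds_trans)
  qed
qed

end
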